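(* Let $k \geq 2$, $p \geq 1$ and $q \geq 1$ be integers. Every $k$-connected graph $G$ of order $$n \geq \max\left\{6(k+p)+8(q-1)-2\left\lceil \frac{k-2}{k} \right\rceil,\ k(q+3)+\max\{(k-2)q-2,2p\}+2\max\{p,q\}-4\right\}$$ with $\delta(G) \geq \frac{n}{2}$ satisfies at least one of the following two properties: (i) for every spanning subgraph $H$ of $G$ with $\Delta(H) \leq p$, the graph $G-E(H)$ is $k$-connected; (ii) there are $q$ pairwise edge-disjoint Hamiltonian cycles $H_1,H_2,\ldots,H_q$ in $G$ such that $G-\bigcup_{1\leq i \leq q}E(H_i)$ is $k$-connected.
   Context: All graphs are finite, simple and undirected. $\delta(G)$ and $\Delta(G)$ denote the minimum and maximum degree. For $F \subseteq E(G)$, $G-F$ is the graph obtained from $G$ by deleting the edges in $F$ (keeping all vertices). A graph is $k$-connected if its vertex connectivity is at least $k$. *)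

theory Defs
  imports Complex_Main
begin

text \<open>
  Simple undirected graphs: an edge is the two-element set of its ends, so loops, multiple edges
  and orientations are excluded by \<open>fin_simple_graph\<close>.
\<close>

record 'a graph =
  verts :: "'a set"
  edges :: "'a set set"

definition fin_simple_graph :: "'a graph \<Rightarrow> bool" where
  "fin_simple_graph G \<longleftrightarrow> finite (verts G) \<and> (\<forall>e\<in>edges G. e \<subseteq> verts G \<and> card e = 2)"

definition order :: "'a graph \<Rightarrow> nat" where
  "order G = card (verts G)"

definition degree :: "'a graph \<Rightarrow> 'a \<Rightarrow> nat" where
  "degree G v = card {e \<in> edges G. v \<in> e}"

text \<open>Minimum and maximum degree are meaningful only for finite graphs with at least one vertex.\<close>

definition min_degree :: "'a graph \<Rightarrow> nat" where
  "min_degree G = Min (degree G ` verts G)"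

definition max_degree :: "'a graph \<Rightarrow> nat" where
  "max_degree G = Max (degree G ` verts G)"

definition spanning_subgraph :: "'a graph \<Rightarrow> 'a graph \<Rightarrow> bool" where
  "spanning_subgraph H G \<longleftrightarrow> verts H = verts G \<and> edges H \<subseteq> edges G"

definition del_edges :: "'a graph \<Rightarrow> 'a set set \<Rightarrow> 'a graph" where
  "del_edges G F = \<lparr>verts = verts G, edges = edges G - F\<rparr>"

definition del_verts :: "'a graph \<Rightarrow> 'a set \<Rightarrow> 'a graph" where
  "del_verts G S = \<lparr>verts = verts G - S, edges = {e \<in> edges G. e \<inter> S = {}}\<rparr>"

definition connected_graph :: "'a graph \<Rightarrow> bool" where
  "connected_graph G \<longleftrightarrow>
     (\<forall>u\<in>verts G. \<forall>v\<in>verts G. (u, v) \<in> {(x, y). {x, y} \<in> edges G}\<^sup>*)"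

text \<open>
  The least number of vertices whose deletion leaves a disconnected graph or at most one vertex.
  The second alternative gives the complete graph on \<open>n\<close> vertices connectivity \<open>n - 1\<close>.
\<close>

definition vertex_connectivity :: "'a graph \<Rightarrow> nat" where
  "vertex_connectivity G =
     (LEAST m. \<exists>S \<subseteq> verts G. card S = m \<and>
        (\<not> connected_graph (del_verts G S) \<or> order (del_verts G S) \<le> 1))"

definition k_connected :: "nat \<Rightarrow> 'a graph \<Rightarrow> bool" where
  "k_connected k G \<longleftrightarrow> vertex_connectivity G \<ge> k"

definition cycle_graph :: "'a graph \<Rightarrow> bool" where
  "cycle_graph C \<longleftrightarrow>
     (\<exists>vs. distinct vs \<and> length vs \<ge> 3 \<and> verts C = set vs \<and>
        edges C = {{vs ! i, vs ! (Suc i mod length vs)} | i. i < length vs})"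

definition hamiltonian_cycle :: "'a graph \<Rightarrow> 'a graph \<Rightarrow> bool" where
  "hamiltonian_cycle C G \<longleftrightarrow> cycle_graph C \<and> spanning_subgraph C G"

end

theory Submission
  imports Defs
begin

text \<open>
  If (i) fails, deleting fewer than \<open>k\<close> vertices \<open>S\<close> leaves two sides \<open>A\<close>, \<open>B\<close> such that every
  vertex has at most \<open>p\<close> neighbours across. By the degree condition both sides are nearly complete.
  Moving each vertex of \<open>S\<close> to the side where it has more neighbours gives a partition of the vertex
  set into two parts \<open>V1\<close>, \<open>V2\<close>. Each part is so dense that, by Bondy--Chvatal closure, one can find
  in it \<open>q\<close> edge-disjoint Hamiltonian paths with prescribed ends, and without them it remains connected
  after the deletion of any \<open>k - 1\<close> vertices. So it remains to choose, among the edges between \<open>V1\<close> and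
  \<open>V2\<close>, \<open>q\<close> disjoint pairs of independent edges that join the paths to Hamiltonian cycles, such that the
  other crossing edges have no vertex cover of size less than \<open>k\<close>. As \<open>G\<close> is \<open>k\<close>-connected, Koenig's
  theorem supplies \<open>k\<close> crossing edges to be kept; since any two vertices on different sides send
  together at least two edges across, the remaining crossing edges are far from being a star, and the
  pairs can be chosen greedily.
\<close>

subsection \<open>Hamiltonian paths with prescribed ends\<close>

text \<open>The set \<open>{v, v}\<close> collapses to \<open>{v}\<close>, so a loop would make
  \<open>v\<close> its own neighbour; hence the recurring assumption that \<open>{v}\<close> is not
  in \<open>E\<close>. Working with a bare edge set lets edges be added and deleted freely.\<close>

definition nbhd :: "'a set set \<Rightarrow> 'a set \<Rightarrow> 'a \<Rightarrow> 'a set" where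
  "nbhd E W v = {w \<in> W. {v, w} \<in> E}"

lemma nbhd_subset: "nbhd E W v \<subseteq> W"
  by (auto simp: nbhd_def)

lemma finite_nbhd [simp]: "finite W \<Longrightarrow> finite (nbhd E W v)"
  by (simp add: nbhd_def)

lemma card_nbhd_le: "finite W \<Longrightarrow> card (nbhd E W v) \<le> card W"
  by (intro card_mono nbhd_subset)

lemma card_nbhd_mono:
  assumes "finite W'" "W \<subseteq> W'" "E \<subseteq> E'"
  shows "card (nbhd E W v) \<le> card (nbhd E' W' v)"
  using assms by (intro card_mono) (auto simp: nbhd_def)

lemma card_nbhd_Un:
  assumes "finite W1" "finite W2"
  shows "card (nbhd E (W1 \<union> W2) v) \<le> card (nbhd E W1 v) + card (nbhd E W2 v)"
proof -
  have "nbhd E (W1 \<union> W2) v = nbhd E W1 v \<union> nbhd E W2 v"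
    by (auto simp: nbhd_def)
  then show ?thesis
    by (simp add: card_Un_le)
qed

lemma card_nbhd_diff:
  assumes "finite W" "card (nbhd F W v) \<le> c"
  shows "card (nbhd E W v) \<le> card (nbhd (E - F) W v) + c"
proof -
  have "nbhd E W v \<subseteq> nbhd (E - F) W v \<union> nbhd F W v"
    by (auto simp: nbhd_def)
  then have "card (nbhd E W v) \<le> card (nbhd (E - F) W v \<union> nbhd F W v)"
    using assms(1) by (intro card_mono) auto
  also have "\<dots> \<le> card (nbhd (E - F) W v) + card (nbhd F W v)"
    by (rule card_Un_le)
  finally show ?thesis
    using assms(2) by linarith
qed

section \<open>Edges of a path given as a vertex list\<close>

fun path_edges :: "'a list \<Rightarrow> 'a set set" where
  "path_edges (x # y # zs) = insert {x, y} (path_edges (y # zs))"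
| "path_edges _ = {}"

lemma path_edges_append:
  assumes "xs \<noteq> []" "ys \<noteq> []"
  shows "path_edges (xs @ ys) = insert {last xs, hd ys} (path_edges xs \<union> path_edges ys)"
  using assms by (induction xs rule: path_edges.induct) (auto simp: neq_Nil_conv)

lemma path_edges_rev: "path_edges (rev xs) = path_edges xs"
proof (induction xs rule: path_edges.induct)
  case (1 x y zs)
  then show ?case
    using path_edges_append[of "rev (y # zs)" "[x]"] by (auto simp: insert_commute)
qed auto

lemma path_edges_subset: "e \<in> path_edges xs \<Longrightarrow> e \<subseteq> set xs"
  by (induction xs rule: path_edges.induct) auto

lemma path_edges_conv_nth: "path_edges xs = {{xs ! i, xs ! Suc i} |i. Suc i < length xs}"
proof (induction xs rule: path_edges.induct)
  case (1 x y zs)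
  show ?case (is "?L = ?R")
  proof
    show "?L \<subseteq> ?R"
    proof
      fix e assume "e \<in> ?L"
      then consider "e = {x, y}" | i where "Suc i < length (y # zs)" "e = {(y # zs) ! i, (y # zs) ! Suc i}"
        using 1 by auto
      then show "e \<in> ?R"
      proof cases
        case 1
        then show ?thesis by (auto intro!: exI[of _ 0])
      next
        case (2 i)
        then show ?thesis by (auto intro!: exI[of _ "Suc i"])
      qed
    qed
    show "?R \<subseteq> ?L"
    proof
      fix e assume "e \<in> ?R"
      then obtain i where i: "Suc i < length (x # y # zs)"
        "e = {(x # y # zs) ! i, (x # y # zs) ! Suc i}" by auto
      then show "e \<in> ?L" using 1 by (cases i) auto
    qed
  qed
qed auto

lemma card_nbhd_path_edges:
  assumes "distinct xs"
  shows "card (nbhd (path_edges xs) W v) \<le> 2"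
proof (cases "v \<in> set xs")
  case True
  then obtain as bs where xs: "xs = as @ v # bs"
    by (meson split_list)
  have as: "v \<notin> set as" and bs: "v \<notin> set bs"
    using assms xs by auto
  \<comment> \<open>When \<open>as\<close> or \<open>bs\<close> is empty, \<open>last as\<close> or
    \<open>hd bs\<close> is an unspecified value; it only enlarges the bounding set.\<close>
  have "nbhd (path_edges xs) W v \<subseteq> {last as, hd bs}"
  proof
    fix w assume "w \<in> nbhd (path_edges xs) W v"
    then have e: "{v, w} \<in> path_edges (as @ v # bs)"
      by (simp add: nbhd_def xs)
    have 1: "{v, w} \<notin> path_edges as" "{v, w} \<notin> path_edges bs"
      using as bs path_edges_subset by blast+
    have 2: "{v, w} \<in> path_edges (v # bs) \<Longrightarrow> w = hd bs"
      using 1 by (cases bs) (auto simp: doubleton_eq_iff)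
    have "w = last as \<or> {v, w} \<in> path_edges (v # bs)"
      using e 1 path_edges_append[of as "v # bs"] by (cases "as = []") (auto simp: doubleton_eq_iff)
    then show "w \<in> {last as, hd bs}"
      using 2 by auto
  qed
  then have "card (nbhd (path_edges xs) W v) \<le> card {last as, hd bs}"
    by (intro card_mono) auto
  also have "\<dots> \<le> 2"
    by (simp add: card_insert_if)
  finally show ?thesis .
next
  case False
  then have "nbhd (path_edges xs) W v = {}"
    using path_edges_subset by (fastforce simp: nbhd_def)
  then show ?thesis by simp
qed

section \<open>Hamiltonian paths and the degree-sum closure\<close>

definition ham_path :: "'a set set \<Rightarrow> 'a set \<Rightarrow> 'a \<Rightarrow> 'a \<Rightarrow> 'a list \<Rightarrow> bool" where
  "ham_path E W x y xs \<longleftrightarrow>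
     distinct xs \<and> xs \<noteq> [] \<and> set xs = W \<and> hd xs = x \<and> last xs = y \<and> path_edges xs \<subseteq> E"

text \<open>Ore's crossing argument with fixed ends. If for some \<open>j\<close> other than
  \<open>i\<close> the set \<open>E\<close> contains the edges from \<open>xs ! i\<close> to
  \<open>xs ! j\<close> and from \<open>xs ! Suc i\<close> to \<open>xs ! Suc j\<close>, reversing
  the segment between the two positions replaces two path edges by these two and keeps both ends.
  Counting neighbours along the path yields such a \<open>j\<close>.\<close>

lemma ham_path_exchange:
  assumes loopfree: "\<And>v. {v} \<notin> E" and sub: "E \<subseteq> E'" and path: "ham_path E' W x y xs"
    and i: "Suc i < length xs" "{xs ! i, xs ! Suc i} \<notin> E"
    and deg: "card W + 1 \<le> card (nbhd E W (xs ! i)) + card (nbhd E W (xs ! Suc i))"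
  shows "\<exists>ys. ham_path E' W x y ys \<and> path_edges ys - E \<subset> path_edges xs - E"
proof -
  have dist: "distinct xs" and W: "set xs = W" and ne: "xs \<noteq> []"
    using path by (auto simp: ham_path_def)
  have cW: "card W = length xs"
    using dist W distinct_card by fastforce
  define m where "m = length xs - 1"
  have m: "length xs = Suc m" using ne by (simp add: m_def)
  \<comment> \<open>Only the last vertex can be missed by \<open>N1\<close> and only the first by
    \<open>N2\<close>, so by \<open>deg\<close> their sizes add up to at least \<open>m\<close>,
    while both lie in a set of \<open>m - 1\<close> indices.\<close>
  define N1 where "N1 = {j \<in> {..<m} - {i}. {xs ! i, xs ! j} \<in> E}"
  define N2 where "N2 = {j \<in> {..<m} - {i}. {xs ! Suc i, xs ! Suc j} \<in> E}"
  have "nbhd E W (xs ! i) \<subseteq> (!) xs ` N1 \<union> {xs ! m}"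
  proof
    fix w assume w: "w \<in> nbhd E W (xs ! i)"
    then obtain j where j: "j < Suc m" "w = xs ! j"
      using W m by (metis (no_types, lifting) nbhd_subset in_set_conv_nth subsetD)
    have "j \<noteq> i" using w loopfree[of "xs ! i"] j by (auto simp: nbhd_def)
    then show "w \<in> (!) xs ` N1 \<union> {xs ! m}"
      using j w by (cases "j = m") (auto simp: N1_def nbhd_def)
  qed
  then have "card (nbhd E W (xs ! i)) \<le> card ((!) xs ` N1 \<union> {xs ! m})"
    by (intro card_mono) (auto simp: N1_def)
  also have "\<dots> \<le> card N1 + 1"
    by (rule order_trans[OF card_Un_le]) (simp add: card_image_le N1_def)
  finally have c1: "card (nbhd E W (xs ! i)) \<le> card N1 + 1" .
  have "nbhd E W (xs ! Suc i) \<subseteq> (\<lambda>j. xs ! Suc j) ` N2 \<union> {xs ! 0}"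
  proof
    fix w assume w: "w \<in> nbhd E W (xs ! Suc i)"
    then obtain j where j: "j < Suc m" "w = xs ! j"
      using W m by (metis (no_types, lifting) nbhd_subset in_set_conv_nth subsetD)
    have "j \<noteq> Suc i" using w loopfree[of "xs ! Suc i"] j by (auto simp: nbhd_def)
    then show "w \<in> (\<lambda>j. xs ! Suc j) ` N2 \<union> {xs ! 0}"
      using j w by (cases j) (auto simp: N2_def nbhd_def)
  qed
  then have "card (nbhd E W (xs ! Suc i)) \<le> card ((\<lambda>j. xs ! Suc j) ` N2 \<union> {xs ! 0})"
    by (intro card_mono) (auto simp: N2_def)
  also have "\<dots> \<le> card N2 + 1"
    by (rule order_trans[OF card_Un_le]) (simp add: card_image_le N2_def)
  finally have c2: "card (nbhd E W (xs ! Suc i)) \<le> card N2 + 1" .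
  have "N1 \<inter> N2 \<noteq> {}"
  proof
    assume "N1 \<inter> N2 = {}"
    then have "card N1 + card N2 = card (N1 \<union> N2)"
      by (intro card_Un_disjoint[symmetric]) (auto simp: N1_def N2_def)
    also have "\<dots> \<le> card ({..<m} - {i})"
      by (intro card_mono) (auto simp: N1_def N2_def)
    also have "\<dots> = m - 1" using i m by simp
    finally show False using c1 c2 deg cW m i by linarith
  qed
  then obtain j where j: "j < m" "j \<noteq> i" "{xs ! i, xs ! j} \<in> E" "{xs ! Suc i, xs ! Suc j} \<in> E"
    by (auto simp: N1_def N2_def)
  \<comment> \<open>The index \<open>j\<close> may lie on either side of \<open>i\<close>; in both
    cases the segment from \<open>xs ! Suc l\<close> to \<open>xs ! h\<close> is reversed.\<close>
  define l where "l = min i j"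
  define h where "h = max i j"
  have lh: "l < h" "h < m" using j i m by (auto simp: l_def h_def)
  have new: "{xs ! l, xs ! h} \<in> E" "{xs ! Suc l, xs ! Suc h} \<in> E"
    using j by (auto simp: l_def h_def min_def max_def insert_commute)
  define as where "as = take (Suc l) xs"
  define bs where "bs = drop (Suc l) (take (Suc h) xs)"
  define cs where "cs = drop (Suc h) xs"
  have xs: "xs = as @ bs @ cs"
  proof -
    have "take (Suc h) xs = take (Suc l) xs @ drop (Suc l) (take (Suc h) xs)"
      using lh append_take_drop_id[of "Suc l" "take (Suc h) xs"] by (simp add: min_def)
    then show ?thesis
      unfolding as_def bs_def cs_def by (metis append.assoc append_take_drop_id)
  qed
  have nes: "as \<noteq> []" "bs \<noteq> []" "cs \<noteq> []"
    using lh m by (auto simp: as_def bs_def cs_def)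
  have ends: "last as = xs ! l" "hd bs = xs ! Suc l" "last bs = xs ! h" "hd cs = xs ! Suc h"
    using lh m nes
    by (auto simp: as_def bs_def cs_def hd_drop_conv_nth last_conv_nth)
  define ys where "ys = as @ rev bs @ cs"
  have pe_ys: "path_edges ys = {{xs ! l, xs ! h}, {xs ! Suc l, xs ! Suc h}}
      \<union> path_edges as \<union> path_edges bs \<union> path_edges cs"
    using nes by (auto simp: ys_def path_edges_append path_edges_rev ends hd_rev last_rev)
  have "path_edges (as @ bs @ cs) = {{xs ! l, xs ! Suc l}, {xs ! h, xs ! Suc h}}
      \<union> path_edges as \<union> path_edges bs \<union> path_edges cs"
    using nes by (auto simp: path_edges_append ends)
  then have pe_xs: "path_edges xs = {{xs ! l, xs ! Suc l}, {xs ! h, xs ! Suc h}}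
      \<union> path_edges as \<union> path_edges bs \<union> path_edges cs"
    by (simp flip: xs)
  have in_as: "xs ! l \<in> set as" and in_bs: "xs ! Suc l \<in> set bs" "xs ! h \<in> set bs" and in_cs: "xs ! Suc h \<in> set cs"
    using nes ends by (metis last_in_set hd_in_set)+
  have disj: "set as \<inter> set bs = {}" "set as \<inter> set cs = {}" "set bs \<inter> set cs = {}"
    using dist xs by auto
  \<comment> \<open>The two removed edges join different pieces, so neither recurs inside a piece.
    This makes the final inclusion strict.\<close>
  have notin: "{xs ! l, xs ! Suc l} \<notin> path_edges as \<union> path_edges bs \<union> path_edges cs"
     "{xs ! h, xs ! Suc h} \<notin> path_edges as \<union> path_edges bs \<union> path_edges cs"
    using in_as in_bs in_cs disj path_edges_subset by blast+
  have "{xs ! i, xs ! Suc i} \<notin> path_edges ys - E"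
    using notin new i by (auto simp: pe_ys l_def h_def min_def max_def split: if_splits)
  moreover have "{xs ! i, xs ! Suc i} \<in> path_edges xs - E"
    using i by (auto simp: path_edges_conv_nth)
  moreover have "path_edges ys - E \<subseteq> path_edges xs - E"
    using new by (auto simp: pe_ys pe_xs)
  moreover have "ham_path E' W x y ys"
  proof -
    have "distinct ys" "set ys = W"
      using dist W xs by (auto simp: ys_def)
    moreover have "hd ys = x" "last ys = y"
      using path nes xs by (auto simp: ys_def ham_path_def)
    moreover have "path_edges ys \<subseteq> E'"
      using path new sub pe_xs pe_ys by (auto simp: ham_path_def)
    ultimately show ?thesis using nes by (simp add: ham_path_def ys_def)
  qed
  ultimately show ?thesis by blast
qed

text \<open>Bondy--Chvatal closure: an exchange strictly decreases the set of path edges outside \<open>E\<close>.\<close>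

lemma ham_path_closure:
  assumes loopfree: "\<And>v. {v} \<notin> E" and sub: "E \<subseteq> E'" and path: "ham_path E' W x y xs"
    and deg: "\<And>u v. u \<in> W \<Longrightarrow> v \<in> W \<Longrightarrow> u \<noteq> v \<Longrightarrow> {u, v} \<in> E' - E \<Longrightarrow>
      card W + 1 \<le> card (nbhd E W u) + card (nbhd E W v)"
  shows "\<exists>ys. ham_path E W x y ys"
  using path
proof (induction "card (path_edges xs - E)" arbitrary: xs rule: less_induct)
  case less
  show ?case
  proof (cases "path_edges xs \<subseteq> E")
    case True
    then show ?thesis using less.prems by (auto simp: ham_path_def)
  next
    case False
    then obtain i where i: "Suc i < length xs" "{xs ! i, xs ! Suc i} \<notin> E"
      by (auto simp: path_edges_conv_nth)
    have "xs ! i \<noteq> xs ! Suc i"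
      using i less.prems by (simp add: ham_path_def nth_eq_iff_index_eq)
    moreover have "{xs ! i, xs ! Suc i} \<in> E'"
      using i less.prems by (auto simp: ham_path_def path_edges_conv_nth)
    moreover have "xs ! i \<in> W" "xs ! Suc i \<in> W"
      using i less.prems by (auto simp: ham_path_def)
    ultimately obtain ys where ys: "ham_path E' W x y ys"
      "path_edges ys - E \<subset> path_edges xs - E"
      using ham_path_exchange[OF loopfree sub less.prems i] deg i by blast
    have fin: "finite (path_edges xs)"
      by (induction xs rule: path_edges.induct) auto
    have "card (path_edges ys - E) < card (path_edges xs - E)"
      using ys fin by (intro psubset_card_mono) auto
    then show ?thesis
      using less.hyps ys(1) by blast
  qed
qed

lemma ham_path_complete:
  assumes "finite W" "x \<in> W" "y \<in> W" "x \<noteq> y" "\<And>u v. u \<in> W \<Longrightarrow> v \<in> W \<Longrightarrow> u \<noteq> v \<Longrightarrow> {u, v} \<in> E"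
  shows "\<exists>xs. ham_path E W x y xs"
proof -
  obtain zs where zs: "set zs = W - {x, y}" "distinct zs"
    using finite_distinct_list[of "W - {x, y}"] assms(1) by auto
  define xs where "xs = x # zs @ [y]"
  have xs: "distinct xs" "set xs = W"
    using zs assms by (auto simp: xs_def)
  have "path_edges xs \<subseteq> E"
  proof
    fix e assume "e \<in> path_edges xs"
    then obtain i where "Suc i < length xs" "e = {xs ! i, xs ! Suc i}"
      by (auto simp: path_edges_conv_nth)
    then show "e \<in> E"
      using xs assms(5) by (auto simp: nth_eq_iff_index_eq)
  qed
  with xs show ?thesis
    by (intro exI[of _ xs]) (simp add: ham_path_def xs_def)
qed

text \<open>Close off the pairs inside \<open>C\<close>, then the pairs between \<open>C\<close> and \<open>L\<close>, then those inside \<open>L\<close>.\<close>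

lemma ham_connected:
  assumes fin: "finite C" "finite L" and disj: "C \<inter> L = {}" and loopfree: "\<And>v. {v} \<notin> E"
    and degC: "\<And>u. u \<in> C \<Longrightarrow> card C + card L + 1 \<le> 2 * card (nbhd E (C \<union> L) u)"
    and degL: "\<And>v. v \<in> L \<Longrightarrow> card L + 2 \<le> card (nbhd E C v)"
    and xy: "x \<in> C \<union> L" "y \<in> C \<union> L" "x \<noteq> y"
  shows "\<exists>xs. ham_path E (C \<union> L) x y xs"
proof -
  define W where "W = C \<union> L"
  define E1 where "E1 = E \<union> {{u, v} |u v. u \<in> C \<and> v \<in> C \<and> u \<noteq> v}"
  define E2 where "E2 = E1 \<union> {{u, v} |u v. u \<in> C \<and> v \<in> L}"
  define E3 where "E3 = E2 \<union> {{u, v} |u v. u \<in> L \<and> v \<in> L \<and> u \<noteq> v}"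
  have finW: "finite W" and cW: "card W = card C + card L"
    using fin disj by (auto simp: W_def card_Un_disjoint)
  have sub: "E \<subseteq> E1" "E1 \<subseteq> E2" "E2 \<subseteq> E3"
    by (auto simp: E1_def E2_def E3_def)
  have lf1: "{v} \<notin> E1" for v
    using loopfree by (auto simp: E1_def)
  have lf2: "{v} \<notin> E2" for v
    using lf1 disj by (auto simp: E2_def)
  have clique: "C - {u} \<subseteq> nbhd E1 W u" if "u \<in> C" for u
    using that by (auto simp: nbhd_def E1_def W_def)
  have join: "C \<subseteq> nbhd E2 W v" if "v \<in> L" for v
    using that by (auto simp: nbhd_def E2_def W_def insert_commute)
  \<comment> \<open>The closure is undone backwards: a path in the complete graph \<open>E3\<close>
    is freed in turn of the added edges inside \<open>L\<close>, between \<open>C\<close> and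
    \<open>L\<close>, and inside \<open>C\<close>.\<close>
  have "\<exists>xs. ham_path E3 W x y xs"
    using xy finW by (intro ham_path_complete) (auto simp: W_def E1_def E2_def E3_def insert_commute)
  then obtain xs3 where xs3: "ham_path E3 W x y xs3" by blast
  have "\<exists>xs. ham_path E2 W x y xs"
  proof (rule ham_path_closure[OF lf2 sub(3) xs3])
    fix u v assume "u \<in> W" "v \<in> W" "u \<noteq> v" "{u, v} \<in> E3 - E2"
    then have uv: "u \<in> L" "v \<in> L"
      by (auto simp: E3_def doubleton_eq_iff)
    then have "card C \<le> card (nbhd E2 W u)" "card C \<le> card (nbhd E2 W v)"
      using join finW by (auto intro!: card_mono)
    moreover have "card L + 2 \<le> card C"
      using degL[OF uv(1)] card_nbhd_le[OF fin(1), of E u] by linarith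
    ultimately show "card W + 1 \<le> card (nbhd E2 W u) + card (nbhd E2 W v)"
      using cW by linarith
  qed
  then obtain xs2 where xs2: "ham_path E2 W x y xs2" by blast
  \<comment> \<open>In \<open>E1\<close> the vertex \<open>u\<close> sees all other vertices of
    \<open>C\<close>, and \<open>v\<close> sees at least \<open>card L + 2\<close> vertices of
    \<open>C\<close>; together this is \<open>card W + 1\<close>.\<close>
  have CL: "card W + 1 \<le> card (nbhd E1 W u) + card (nbhd E1 W v)" if "u \<in> C" "v \<in> L" for u v
  proof -
    have "card C - 1 \<le> card (nbhd E1 W u)"
      using clique[OF that(1)] finW that(1) fin by (metis card_Diff_singleton card_mono finite_nbhd)
    moreover have "card (nbhd E C v) \<le> card (nbhd E1 W v)"
      using sub finW by (intro card_nbhd_mono) (auto simp: W_def)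
    moreover have "card C > 0" using that fin by (auto simp: card_gt_0_iff)
    ultimately show ?thesis
      using degL[OF that(2)] cW by linarith
  qed
  have "\<exists>xs. ham_path E1 W x y xs"
  proof (rule ham_path_closure[OF lf1 sub(2) xs2])
    fix u v assume "u \<in> W" "v \<in> W" "u \<noteq> v" "{u, v} \<in> E2 - E1"
    then have "u \<in> C \<and> v \<in> L \<or> v \<in> C \<and> u \<in> L"
      by (auto simp: E2_def doubleton_eq_iff)
    then show "card W + 1 \<le> card (nbhd E1 W u) + card (nbhd E1 W v)"
      using CL[of u v] CL[of v u] by linarith
  qed
  then obtain xs1 where xs1: "ham_path E1 W x y xs1" by blast
  have "\<exists>xs. ham_path E W x y xs"
  proof (rule ham_path_closure[OF loopfree sub(1) xs1])
    fix u v assume "u \<in> W" "v \<in> W" "u \<noteq> v" "{u, v} \<in> E1 - E"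
    then have "u \<in> C" "v \<in> C"
      by (auto simp: E1_def doubleton_eq_iff)
    then show "card W + 1 \<le> card (nbhd E W u) + card (nbhd E W v)"
      using degC[of u] degC[of v] cW by (simp add: W_def)
  qed
  then show ?thesis by (simp add: W_def)
qed

lemma card_nbhd_paths:
  fixes q :: nat
  assumes "\<And>i. i < q \<Longrightarrow> distinct (P i)"
  shows "card (nbhd (\<Union>i<q. path_edges (P i)) W v) \<le> 2 * q"
proof -
  have "nbhd (\<Union>i<q. path_edges (P i)) W v = (\<Union>i<q. nbhd (path_edges (P i)) W v)"
    by (auto simp: nbhd_def)
  also have "card \<dots> \<le> (\<Sum>i<q. card (nbhd (path_edges (P i)) W v))"
    by (rule card_UN_le) simp
  also have "\<dots> \<le> (\<Sum>i<q. 2)"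
    using assms by (intro sum_mono card_nbhd_path_edges) auto
  finally show ?thesis by simp
qed

text \<open>The paths are chosen greedily: each takes at most two edges at a vertex. Before the last
  choice \<open>q - 1\<close> paths are gone, which costs \<open>4 * q - 4\<close> in the doubled
  degrees of \<open>degC\<close>, and \<open>ham_connected\<close> asks for one more; hence the
  constant 3.\<close>

lemma disjoint_ham_paths:
  fixes q :: nat
  assumes fin: "finite C" "finite L" and disj: "C \<inter> L = {}" and loopfree: "\<And>v. {v} \<notin> E"
    and degC: "\<And>u. u \<in> C \<Longrightarrow> card C + card L + 4 * q \<le> 2 * card (nbhd E (C \<union> L) u) + 3"
    and degL: "\<And>v. v \<in> L \<Longrightarrow> card L + 2 * q \<le> card (nbhd E C v)"
    and xy: "\<And>i. i < q \<Longrightarrow> x i \<in> C \<union> L \<and> y i \<in> C \<union> L \<and> x i \<noteq> y i"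
  shows "\<exists>P. (\<forall>i<q. ham_path E (C \<union> L) (x i) (y i) (P i)) \<and>
    (\<forall>i<q. \<forall>j<q. i \<noteq> j \<longrightarrow> path_edges (P i) \<inter> path_edges (P j) = {})"
  using degC degL xy
proof (induction q)
  case 0
  then show ?case by simp
next
  case (Suc q)
  have "\<exists>P. (\<forall>i<q. ham_path E (C \<union> L) (x i) (y i) (P i)) \<and>
    (\<forall>i<q. \<forall>j<q. i \<noteq> j \<longrightarrow> path_edges (P i) \<inter> path_edges (P j) = {})"
  proof (rule Suc.IH)
    show "card C + card L + 4 * q \<le> 2 * card (nbhd E (C \<union> L) u) + 3" if "u \<in> C" for u
      using Suc.prems(1)[OF that] by simp
    show "card L + 2 * q \<le> card (nbhd E C v)" if "v \<in> L" for v
      using Suc.prems(2)[OF that] by simp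
  qed (use Suc.prems(3) in auto)
  then obtain P where P: "\<And>i. i < q \<Longrightarrow> ham_path E (C \<union> L) (x i) (y i) (P i)"
    "\<And>i j. i < q \<Longrightarrow> j < q \<Longrightarrow> i \<noteq> j \<Longrightarrow> path_edges (P i) \<inter> path_edges (P j) = {}"
    by blast
  define F where "F = (\<Union>i<q. path_edges (P i))"
  have F: "card (nbhd F W v) \<le> 2 * q" for W v
    unfolding F_def using P(1) by (intro card_nbhd_paths) (auto simp: ham_path_def)
  have "\<exists>xs. ham_path (E - F) (C \<union> L) (x q) (y q) xs"
  proof (rule ham_connected[OF fin disj])
    show "{v} \<notin> E - F" for v using loopfree by auto
    show "card C + card L + 1 \<le> 2 * card (nbhd (E - F) (C \<union> L) u)" if "u \<in> C" for u
      using Suc.prems(1)[OF that] card_nbhd_diff[OF _ F, of "C \<union> L" E u] fin by simp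
    show "card L + 2 \<le> card (nbhd (E - F) C v)" if "v \<in> L" for v
      using Suc.prems(2)[OF that] card_nbhd_diff[OF _ F, of C E v] fin by simp
  qed (use Suc.prems(3) in auto)
  then obtain xs where xs: "ham_path (E - F) (C \<union> L) (x q) (y q) xs" by blast
  define P' where "P' = P(q := xs)"
  have new: "path_edges xs \<inter> path_edges (P i) = {}" if "i < q" for i
    using xs that by (auto simp: ham_path_def F_def)
  have "\<forall>i<Suc q. ham_path E (C \<union> L) (x i) (y i) (P' i)"
    using P(1) xs by (auto simp: P'_def less_Suc_eq ham_path_def)
  moreover have "\<forall>i<Suc q. \<forall>j<Suc q. i \<noteq> j \<longrightarrow> path_edges (P' i) \<inter> path_edges (P' j) = {}"
    using P(2) new by (auto simp: P'_def less_Suc_eq)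
  ultimately show ?case by blast
qed

text \<open>By counting, two nonadjacent surviving vertices of \<open>C\<close> have a common surviving neighbour in
  \<open>C\<close>.\<close>

lemma connected_after_deletion:
  fixes q t :: nat
  assumes fin: "finite C" "finite T" and loopfree: "\<And>v. {v} \<notin> E"
    and degC: "\<And>u. u \<in> C \<Longrightarrow> card C + 4 * q + t \<le> 2 * card (nbhd E C u) + 1"
    and degL: "\<And>v. v \<in> L \<Longrightarrow> 2 * q + t + 1 \<le> card (nbhd E C v)"
    and F: "\<And>W v. card (nbhd F W v) \<le> 2 * q"
    and T: "card T \<le> t"
    and uv: "u \<in> C \<union> L - T" "v \<in> C \<union> L - T"
  shows "(u, v) \<in> {(x, y). x \<notin> T \<and> y \<notin> T \<and> {x, y} \<in> E - F}\<^sup>*" (is "_ \<in> ?R\<^sup>*")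
proof -
  have sym: "sym ?R" by (auto simp: sym_def insert_commute)
  have CC: "(a, b) \<in> ?R\<^sup>*" if ab: "a \<in> C - T" "b \<in> C - T" for a b
  proof (cases "a = b \<or> (a, b) \<in> ?R")
    case True
    then show ?thesis by blast
  next
    case False
    define Na where "Na = nbhd (E - F) C a - T"
    define Nb where "Nb = nbhd (E - F) C b - T"
    define C' where "C' = C - T"
    have ft: "finite Na" "finite Nb" "finite C'"
      using fin by (auto simp: Na_def Nb_def C'_def)
    define s where "s = card (C \<inter> T)"
    have st: "s \<le> t" unfolding s_def using T fin by (meson Int_lower2 card_mono order_trans)
    have sC: "card C' + s = card C"
      unfolding C'_def s_def using fin card_Int_Diff[of C T] by linarith
    have "card (nbhd (E - F) C c) \<le> card (nbhd (E - F) C c - T) + s" for c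
    proof -
      have "nbhd (E - F) C c \<subseteq> (nbhd (E - F) C c - T) \<union> (C \<inter> T)"
        by (auto simp: nbhd_def)
      then have "card (nbhd (E - F) C c) \<le> card ((nbhd (E - F) C c - T) \<union> (C \<inter> T))"
        using fin by (intro card_mono) auto
      then show ?thesis
        using card_Un_le[of "nbhd (E - F) C c - T" "C \<inter> T"] by (simp add: s_def)
    qed
    then have "card (nbhd E C a) \<le> card Na + s + 2 * q" "card (nbhd E C b) \<le> card Nb + s + 2 * q"
      unfolding Na_def Nb_def
      using card_nbhd_diff[OF fin(1) F, of E a] card_nbhd_diff[OF fin(1) F, of E b]
      by (meson add_le_mono1 order_trans)+
    \<comment> \<open>Deleting \<open>T\<close> costs the two neighbourhoods up to
      \<open>2 * s\<close> in all, while \<open>C\<close> shrinks only by \<open>s\<close>. The term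
      \<open>t\<close> in \<open>degC\<close> pays for the difference, as \<open>s\<close> is at
      most \<open>t\<close>.\<close>
    then have sum: "card C' \<le> card Na + card Nb + 1"
      using degC[of a] degC[of b] ab sC st by auto
    have two: "2 \<le> card C'"
      using False ab ft card_mono[of C' "{a, b}"] by (simp add: C'_def)
    have "Na \<inter> Nb \<noteq> {}"
    proof
      assume "Na \<inter> Nb = {}"
      then have "card Na + card Nb = card (Na \<union> Nb)"
        using ft by (simp add: card_Un_disjoint)
      also have "\<dots> \<le> card (C' - {a, b})"
        using ft False ab loopfree
        by (intro card_mono) (auto simp: Na_def Nb_def C'_def nbhd_def insert_commute)
      also have "\<dots> = card C' - 2"
        using False ab ft by (simp add: C'_def card_Diff_subset)
      finally show False using sum two by linarith
    qed
    then obtain c where "c \<in> Na" "c \<in> Nb" by blast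
    then have "(a, c) \<in> ?R" "(c, b) \<in> ?R"
      using ab by (auto simp: Na_def Nb_def nbhd_def insert_commute)
    then show ?thesis by (meson r_into_rtrancl rtrancl_trans)
  qed
  \<comment> \<open>A vertex of \<open>L\<close> keeps more than \<open>card T\<close> neighbours in
    \<open>C\<close>, so one of them survives; this reduces the claim to vertices of
    \<open>C\<close>.\<close>
  have toC: "\<exists>b\<in>C - T. (a, b) \<in> ?R\<^sup>*" if a: "a \<in> C \<union> L - T" for a
  proof (cases "a \<in> C")
    case True
    then show ?thesis using a by blast
  next
    case False
    then have "2 * q + t + 1 \<le> card (nbhd E C a)" using a degL by blast
    then have "card T < card (nbhd (E - F) C a)"
      using card_nbhd_diff[OF fin(1) F, of E a] T by linarith
    then have "\<not> nbhd (E - F) C a \<subseteq> T"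
      using fin by (metis card_mono leD)
    then obtain b where "b \<in> nbhd (E - F) C a" "b \<notin> T" by blast
    then show ?thesis using a by (intro bexI[of _ b]) (auto simp: nbhd_def)
  qed
  obtain a b where ab: "a \<in> C - T" "(u, a) \<in> ?R\<^sup>*" "b \<in> C - T" "(v, b) \<in> ?R\<^sup>*"
    using toC uv by meson
  have "(b, v) \<in> ?R\<^sup>*" using ab(4) sym by (meson sym_rtrancl symD)
  then show ?thesis using ab CC by (meson rtrancl_trans)
qed

subsection \<open>Crossing edges\<close>

text \<open>Crossing edges are ordered pairs, the first end on the first side, so that
  \<open>fst\<close> and \<open>snd\<close> name the ends by side.\<close>

definition covers :: "'a set \<Rightarrow> ('a \<times> 'a) set \<Rightarrow> bool" where
  "covers T X \<longleftrightarrow> (\<forall>(a, b)\<in>X. a \<in> T \<or> b \<in> T)"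

text \<open>Lovasz's argument for Koenig's theorem: if two edges of a minimal uncoverable graph share an
  end, then covers of the two edge-deleted subgraphs combine to a small cover of the whole graph,
  because the smaller side of a bipartite graph covers all its edges.\<close>

lemma minimal_uncoverable_share:
  assumes X: "X \<subseteq> A \<times> B" "A \<inter> B = {}" and k: "k \<ge> 1"
    and unc: "\<And>T. finite T \<Longrightarrow> card T < k \<Longrightarrow> \<not> covers T X"
    and e: "e1 \<in> X" "e2 \<in> X" "e1 \<noteq> e2" and v: "v \<in> {fst e1, snd e1} \<inter> {fst e2, snd e2}"
    and S: "finite S1" "card S1 < k" "covers S1 (X - {e1})"
      "finite S2" "card S2 < k" "covers S2 (X - {e2})"
  shows False
proof -
  have nc: "\<not> covers S1 X" "\<not> covers S2 X" using unc S by auto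
  have nS1: "fst e1 \<notin> S1" "snd e1 \<notin> S1"
    using nc(1) S(3) by (auto simp: covers_def)
  have nS2: "fst e2 \<notin> S2" "snd e2 \<notin> S2"
    using nc(2) S(6) by (auto simp: covers_def)
  \<comment> \<open>Every edge of \<open>X\<close> meets \<open>S1 \<inter> S2\<close> or has both
    ends in \<open>D\<close>. For \<open>e1\<close> and \<open>e2\<close> these ends are the shared
    \<open>v\<close> and the one caught by the cover that omits the other edge. So the smaller side
    of \<open>D\<close>, together with \<open>S1 \<inter> S2\<close>, covers
    \<open>X\<close>.\<close>
  define D where "D = insert v ((S1 - S2) \<union> (S2 - S1))"
  have finD: "finite D" using S by (simp add: D_def)
  define t where "t = card (S1 \<inter> S2)"
  have c: "card (S1 - S2) + t = card S1" "card (S2 - S1) + t = card S2"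
    unfolding t_def using S card_Int_Diff[of S1 S2] card_Int_Diff[of S2 S1] by (simp_all add: Int_commute)
  have "card D \<le> card (S1 - S2) + card (S2 - S1) + 1"
    unfolding D_def using S card_Un_le[of "S1 - S2" "S2 - S1"] by (simp add: card_insert_if)
  \<comment> \<open>The right-hand side is odd, so halving rounds down to \<open>k - 1\<close>; this
    is what keeps \<open>card T\<close> below \<open>k\<close>.\<close>
  then have cD: "card D + 2 * t \<le> 2 * (k - 1) + 1"
    using c S by linarith
  have "card (D \<inter> A) + card (D \<inter> B) \<le> card D"
    using X finD by (subst card_Un_disjoint[symmetric]) (auto intro!: card_mono)
  then have "2 * card (D \<inter> A) \<le> card D \<or> 2 * card (D \<inter> B) \<le> card D"
    by linarith
  then obtain Z where Z: "Z = D \<inter> A \<or> Z = D \<inter> B" "2 * card Z \<le> card D"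
    by metis
  define T where "T = Z \<union> (S1 \<inter> S2)"
  have "card T \<le> card Z + t"
    unfolding T_def t_def by (rule card_Un_le)
  then have "card T < k" using Z(2) cD k by linarith
  moreover have "finite T" using Z(1) finD S by (auto simp: T_def)
  moreover have "covers T X"
    unfolding covers_def
  proof clarify
    fix a b assume ab: "(a, b) \<in> X" "b \<notin> T"
    have AB: "a \<in> A" "b \<in> B" using ab X by auto
    have D: "a \<in> T" if "a \<in> D" "b \<in> D"
      using that AB Z(1) ab(2) by (auto simp: T_def)
    have S12: "a \<in> S1 \<inter> S2 \<Longrightarrow> a \<in> T" "b \<notin> S1 \<inter> S2"
      using ab by (auto simp: T_def)
    consider "(a, b) = e1" | "(a, b) = e2" | "(a, b) \<noteq> e1" "(a, b) \<noteq> e2" by blast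
    then show "a \<in> T"
    proof cases
      case 1
      then have "a \<in> S2 \<or> b \<in> S2" using S(6) e ab by (auto simp: covers_def)
      moreover have "v \<notin> S2" using nS2 v by auto
      ultimately have "a \<in> D \<and> b \<in> D" using 1 v nS1 by (auto simp: D_def)
      then show ?thesis using D by blast
    next
      case 2
      then have "a \<in> S1 \<or> b \<in> S1" using S(3) e ab by (auto simp: covers_def)
      moreover have "v \<notin> S1" using nS1 v by auto
      ultimately have "a \<in> D \<and> b \<in> D" using 2 v nS2 by (auto simp: D_def)
      then show ?thesis using D by blast
    next
      case 3
      then have "a \<in> S1 \<or> b \<in> S1" "a \<in> S2 \<or> b \<in> S2"
        using S ab by (auto simp: covers_def)
      then show ?thesis using D S12 by (auto simp: D_def)
    qed
  qed
  ultimately show False using unc by blast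
qed

text \<open>Discard edges as long as the rest stays uncoverable. Once every edge is critical, no two
  share an end, so a cover of all edges but one contains a different vertex for each of them. It has
  fewer than \<open>k\<close> vertices, hence at most \<open>k\<close> edges are left.\<close>

lemma small_uncoverable_subset:
  assumes "finite X" "X \<subseteq> A \<times> B" "A \<inter> B = {}" "k \<ge> 1"
    and "\<And>T. finite T \<Longrightarrow> card T < k \<Longrightarrow> \<not> covers T X"
  shows "\<exists>M \<subseteq> X. card M \<le> k \<and> (\<forall>T. finite T \<longrightarrow> card T < k \<longrightarrow> \<not> covers T M)"
  using assms
proof (induction "card X" arbitrary: X rule: less_induct)
  case less
  show ?case
  proof (cases "\<exists>e\<in>X. \<forall>T. finite T \<longrightarrow> card T < k \<longrightarrow> \<not> covers T (X - {e})")
    case True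
    then obtain e where e: "e \<in> X" "\<And>T. finite T \<Longrightarrow> card T < k \<Longrightarrow> \<not> covers T (X - {e})"
      by blast
    have "\<exists>M \<subseteq> X - {e}. card M \<le> k \<and> (\<forall>T. finite T \<longrightarrow> card T < k \<longrightarrow> \<not> covers T M)"
      using less.prems e by (intro less.hyps) (auto simp del: card_Diff_insert intro!: card_Diff1_less)
    then show ?thesis by blast
  next
    case False
    then have crit: "\<exists>T. finite T \<and> card T < k \<and> covers T (X - {e})" if "e \<in> X" for e
      using that by blast
    have disjoint: "{fst e1, snd e1} \<inter> {fst e2, snd e2} = {}" if e: "e1 \<in> X" "e2 \<in> X" "e1 \<noteq> e2" for e1 e2
    proof (rule ccontr)
      assume "{fst e1, snd e1} \<inter> {fst e2, snd e2} \<noteq> {}"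
      then obtain v where "v \<in> {fst e1, snd e1} \<inter> {fst e2, snd e2}" by blast
      with crit[OF e(1)] crit[OF e(2)] show False
        using minimal_uncoverable_share[OF less.prems(2-5) e] by blast
    qed
    have "card X \<le> k"
    proof (cases "X = {}")
      case False
      then obtain e where e: "e \<in> X" by blast
      obtain T where T: "finite T" "card T < k" "covers T (X - {e})"
        using crit[OF e] by blast
      define f where "f d = (if fst d \<in> T then fst d else snd d)" for d :: "'a \<times> 'a"
      have "inj_on f (X - {e})"
      proof (rule inj_onI)
        fix d d' assume "d \<in> X - {e}" "d' \<in> X - {e}" "f d = f d'"
        then show "d = d'" using disjoint[of d d'] by (auto simp: f_def split: if_splits)
      qed
      moreover have "f ` (X - {e}) \<subseteq> T"
        using T(3) by (auto simp: f_def covers_def)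
      ultimately have "card (X - {e}) \<le> card T"
        using T(1) by (metis card_image card_mono)
      then show ?thesis using T(2) e less.prems(1) by (simp add: card_Diff_singleton)
    qed simp
    then show ?thesis using less.prems by blast
  qed
qed

text \<open>Pairwise intersecting edges form a star or a triangle; \<open>avoid\<close> excludes the
  star and the bipartition the triangle. Concretely, an edge avoiding \<open>a\<close> and an edge
  avoiding \<open>b\<close> are independent of each other unless one of them is independent of
  \<open>(a, b)\<close>.\<close>

lemma two_disjoint_pairs:
  assumes ne: "Z \<noteq> {}" and AB: "Z \<subseteq> A \<times> B" "A \<inter> B = {}"
    and avoid: "\<And>v. v \<in> A \<union> B \<Longrightarrow> \<exists>(a, b)\<in>Z. a \<noteq> v \<and> b \<noteq> v"
  shows "\<exists>e\<in>Z. \<exists>f\<in>Z. fst e \<noteq> fst f \<and> snd e \<noteq> snd f"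
proof -
  obtain a b where ab: "(a, b) \<in> Z" using ne by auto
  obtain c d where cd: "(c, d) \<in> Z" "c \<noteq> a" using avoid[of a] ab AB by blast
  obtain g h where gh: "(g, h) \<in> Z" "h \<noteq> b" using avoid[of b] ab AB by blast
  have "d \<noteq> b \<or> g \<noteq> a \<or> (c \<noteq> g \<and> b \<noteq> h)" using cd gh by auto
  then consider "d \<noteq> b" | "g \<noteq> a" | "d = b" "g = a" by auto
  then show ?thesis
  proof cases
    case 1
    then show ?thesis using ab cd by (intro bexI[of _ "(a, b)"] bexI[of _ "(c, d)"]) auto
  next
    case 2
    then show ?thesis using ab gh by (intro bexI[of _ "(a, b)"] bexI[of _ "(g, h)"]) auto
  next
    case 3
    then show ?thesis using cd gh by (intro bexI[of _ "(c, d)"] bexI[of _ "(g, h)"]) auto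
  qed
qed

text \<open>The edges \<open>e i\<close> and \<open>f i\<close> will carry the \<open>i\<close>-th
  cycle across the cut, so they must be independent. Distinct cycles need distinct crossing edges,
  but these may share ends.\<close>

definition edge_pairs :: "('a \<times> 'a) set \<Rightarrow> nat \<Rightarrow> (nat \<Rightarrow> 'a \<times> 'a) \<Rightarrow> (nat \<Rightarrow> 'a \<times> 'a) \<Rightarrow> bool" where
  "edge_pairs Z q e f \<longleftrightarrow>
     (\<forall>i<q. e i \<in> Z \<and> f i \<in> Z \<and> fst (e i) \<noteq> fst (f i) \<and> snd (e i) \<noteq> snd (f i)) \<and>
     (\<forall>i<q. \<forall>j<q. i \<noteq> j \<longrightarrow> {e i, f i} \<inter> {e j, f j} = {})"

lemma many_disjoint_pairs:
  fixes q :: nat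
  assumes fin: "finite X" "finite M" and AB: "X \<subseteq> A \<times> B" "A \<inter> B = {}"
    and avoid: "\<And>v. card M + 2 * q \<le> card {e \<in> X. fst e \<noteq> v \<and> snd e \<noteq> v} + 1"
  shows "\<exists>e f. edge_pairs (X - M) q e f"
  using avoid
proof (induction q)
  case 0
  then show ?case by (simp add: edge_pairs_def)
next
  case (Suc q)
  have "\<exists>e f. edge_pairs (X - M) q e f"
  proof (rule Suc.IH)
    show "card M + 2 * q \<le> card {e \<in> X. fst e \<noteq> v \<and> snd e \<noteq> v} + 1" for v
      using Suc.prems[of v] by simp
  qed
  then obtain e f where "edge_pairs (X - M) q e f" by blast
  then have ef: "\<And>i. i < q \<Longrightarrow> e i \<in> X - M \<and> f i \<in> X - M \<and> fst (e i) \<noteq> fst (f i) \<and> snd (e i) \<noteq> snd (f i)"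
    "\<And>i j. i < q \<Longrightarrow> j < q \<Longrightarrow> i \<noteq> j \<Longrightarrow> {e i, f i} \<inter> {e j, f j} = {}"
    unfolding edge_pairs_def by simp_all
  define U where "U = M \<union> (\<Union>i<q. {e i, f i})"
  have finU: "finite U" using fin by (simp add: U_def)
  have "card (\<Union>i<q. {e i, f i}) \<le> (\<Sum>i<q. card {e i, f i})"
    by (rule card_UN_le) simp
  also have "\<dots> \<le> (\<Sum>i<q. 2)"
    by (intro sum_mono) (simp add: card_insert_if)
  finally have cU: "card U \<le> card M + 2 * q"
    unfolding U_def using card_Un_le[of M "\<Union>i<q. {e i, f i}"] by simp
  have av: "\<exists>(a, b)\<in>X - U. a \<noteq> v \<and> b \<noteq> v" for v
  proof (rule ccontr)
    assume "\<not> ?thesis"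
    then have "{e \<in> X. fst e \<noteq> v \<and> snd e \<noteq> v} \<subseteq> U" by auto
    then have "card {e \<in> X. fst e \<noteq> v \<and> snd e \<noteq> v} \<le> card U"
      using finU by (rule card_mono[rotated])
    then show False using Suc.prems[of v] cU by simp
  qed
  have "\<exists>g\<in>X - U. \<exists>h\<in>X - U. fst g \<noteq> fst h \<and> snd g \<noteq> snd h"
    using av AB by (intro two_disjoint_pairs[of _ A B]) fastforce+
  then obtain g h where gh: "g \<in> X - U" "h \<in> X - U" "fst g \<noteq> fst h" "snd g \<noteq> snd h" by blast
  have new: "{g, h} \<inter> {e i, f i} = {}" if "i < q" for i
    using gh that by (auto simp: U_def)
  show ?case
  proof (rule exI[of _ "e(q := g)"], rule exI[of _ "f(q := h)"], unfold edge_pairs_def, intro conjI allI impI)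
    fix i j assume "i < Suc q" "j < Suc q" "i \<noteq> j"
    then show "{(e(q := g)) i, (f(q := h)) i} \<inter> {(e(q := g)) j, (f(q := h)) j} = {}"
      using ef(2)[of i j] new[of i] new[of j] by (auto simp: less_Suc_eq)
  qed (use ef(1) gh in \<open>auto simp: less_Suc_eq U_def\<close>)
qed

text \<open>If some \<open>a\<close> and some \<open>b\<close>, both other than \<open>v\<close>,
  had all their crossing edges at \<open>v\<close>, they would together have at most one, since
  \<open>v\<close> lies on at most one side. So the edges avoiding \<open>v\<close> reach every
  vertex other than \<open>v\<close> of one of the sides.\<close>

lemma card_pairs_avoiding:
  assumes fin: "finite A" "finite B" and AB: "X \<subseteq> A \<times> B" "A \<inter> B = {}"
    and deg: "\<And>a b. a \<in> A \<Longrightarrow> b \<in> B \<Longrightarrow> 2 \<le> card {y. (a, y) \<in> X} + card {x. (x, b) \<in> X}"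
    and m: "m \<le> card A" "m \<le> card B"
  shows "m \<le> card {e \<in> X. fst e \<noteq> v \<and> snd e \<noteq> v} + 1" (is "m \<le> card ?Y + 1")
proof -
  have finX: "finite X" using fin AB finite_subset by blast
  have "(\<forall>b\<in>B - {v}. \<exists>e\<in>?Y. snd e = b) \<or> (\<forall>a\<in>A - {v}. \<exists>e\<in>?Y. fst e = a)"
  proof (rule ccontr)
    assume "\<not> ?thesis"
    then obtain a b where a: "a \<in> A" "a \<noteq> v" "\<And>y. (a, y) \<in> X \<Longrightarrow> y = v"
      and b: "b \<in> B" "b \<noteq> v" "\<And>x. (x, b) \<in> X \<Longrightarrow> x = v"
      by fastforce
    have "{y. (a, y) \<in> X} \<subseteq> (if v \<in> B then {v} else {})" "{x. (x, b) \<in> X} \<subseteq> (if v \<in> A then {v} else {})"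
      using a b AB by auto
    then have "card {y. (a, y) \<in> X} \<le> card (if v \<in> B then {v} else {})"
      "card {x. (x, b) \<in> X} \<le> card (if v \<in> A then {v} else {})"
      by (intro card_mono; simp)+
    then show False using deg[OF a(1) b(1)] AB(2) by (auto split: if_splits)
  qed
  then have "B - {v} \<subseteq> snd ` ?Y \<or> A - {v} \<subseteq> fst ` ?Y"
    by (metis (no_types, lifting) image_eqI subsetI)
  then have "card (B - {v}) \<le> card ?Y \<or> card (A - {v}) \<le> card ?Y"
    using finX surj_card_le[of ?Y] by (auto simp del: mem_Collect_eq)
  moreover have "card B \<le> card (B - {v}) + 1" "card A \<le> card (A - {v}) + 1"
    using fin by (auto simp: card_Diff_singleton_if)
  ultimately show ?thesis using m by linarith
qed

subsection \<open>Packing Hamiltonian cycles across a sparse cut\<close>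

text \<open>The deletion of \<open>T\<close> is built into the relation. Being reflexive, it
  contains \<open>(u, u)\<close> also for \<open>u\<close> in \<open>T\<close>, so connectivity
  statements restrict the ends to vertices outside \<open>T\<close>.\<close>

definition reach :: "'a set set \<Rightarrow> 'a set \<Rightarrow> ('a \<times> 'a) set" where
  "reach E T = {(x, y). x \<notin> T \<and> y \<notin> T \<and> {x, y} \<in> E}\<^sup>*"

lemma reach_sym: "(u, v) \<in> reach E T \<Longrightarrow> (v, u) \<in> reach E T"
proof -
  have "sym {(x, y). x \<notin> T \<and> y \<notin> T \<and> {x, y} \<in> E}"
    by (auto simp: sym_def insert_commute)
  then show "(u, v) \<in> reach E T \<Longrightarrow> (v, u) \<in> reach E T"
    unfolding reach_def by (meson sym_rtrancl symD)
qed

lemma reach_trans: "(u, v) \<in> reach E T \<Longrightarrow> (v, w) \<in> reach E T \<Longrightarrow> (u, w) \<in> reach E T"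
  unfolding reach_def by (rule rtrancl_trans)

lemma reach_edge: "u \<notin> T \<Longrightarrow> v \<notin> T \<Longrightarrow> {u, v} \<in> E \<Longrightarrow> (u, v) \<in> reach E T"
  unfolding reach_def by auto

lemma reach_mono: "E \<subseteq> E' \<Longrightarrow> reach E T \<subseteq> reach E' T"
  unfolding reach_def by (intro rtrancl_mono) auto

lemma reach_crossing:
  assumes "(u, v) \<in> reach E T" "u \<in> W" "v \<notin> W"
  shows "\<exists>x y. x \<in> W \<and> y \<notin> W \<and> x \<notin> T \<and> y \<notin> T \<and> {x, y} \<in> E"
proof (rule ccontr)
  assume no: "\<not> ?thesis"
  have "v \<in> W"
    using assms(1) unfolding reach_def
  proof (induction rule: rtrancl_induct)
    case base
    then show ?case by (rule assms(2))
  next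
    case (step y z)
    then show ?case using no by blast
  qed
  with assms(3) show False by blast
qed

text \<open>A vertex of \<open>A\<close> has at most \<open>p\<close> neighbours in \<open>B\<close>
  and fewer than \<open>k\<close> in \<open>S\<close>, so the rest of its \<open>d\<close>
  neighbours make \<open>A\<close> large; the same count for \<open>B\<close> bounds
  \<open>A\<close> from above. The conclusions feed \<open>disjoint_ham_paths\<close>,
  \<open>connected_side\<close> and the choice of crossing edges. The lemma serves each side in
  turn, with \<open>L\<close> the part of \<open>S\<close> moved to that side.\<close>

lemma side_degrees:
  fixes k p q n d :: nat
  assumes fin: "finite A" "finite B" "finite S"
    and disj: "A \<inter> B = {}" "A \<inter> S = {}" "B \<inter> S = {}" and ne: "A \<noteq> {}" "B \<noteq> {}"
    and n: "card (A \<union> B \<union> S) = n" and loopfree: "\<And>v. {v} \<notin> E"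
    and deg: "\<And>v. v \<in> A \<union> B \<union> S \<Longrightarrow> d \<le> card (nbhd E (A \<union> B \<union> S) v)" and d: "n \<le> 2 * d"
    and cA: "\<And>a. a \<in> A \<Longrightarrow> card (nbhd E B a) \<le> p" and cB: "\<And>b. b \<in> B \<Longrightarrow> card (nbhd E A b) \<le> p"
    and S: "card S < k" and bound: "6 * k + 6 * p + 8 * q \<le> n + 10" and pq: "p \<ge> 1" "q \<ge> 1"
    and L: "L \<subseteq> S" "\<And>v. v \<in> L \<Longrightarrow> card (nbhd E B v) \<le> card (nbhd E A v)"
  shows "\<And>a. a \<in> A \<Longrightarrow> card A + card L + 4 * q \<le> 2 * card (nbhd E (A \<union> L) a) + 3"
    and "\<And>a. a \<in> A \<Longrightarrow> card A + 4 * q + (k - 1) \<le> 2 * card (nbhd E A a) + 1"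
    and "\<And>v. v \<in> L \<Longrightarrow> k + 2 * q \<le> card (nbhd E A v)"
    and "k + 2 * q \<le> card A"
proof -
  have cn: "card A + card B + card S = n"
    using fin disj n by (subst n[symmetric]) (simp add: card_Un_disjoint Int_Un_distrib2)
  have self: "card (nbhd E W v) + 1 \<le> card W" if "v \<in> W" "finite W" for W v
  proof -
    have "nbhd E W v \<subseteq> W - {v}" using loopfree by (auto simp: nbhd_def)
    then have "card (nbhd E W v) < card W"
      using that by (intro psubset_card_mono) auto
    then show ?thesis by simp
  qed
  have split: "d \<le> card (nbhd E A v) + card (nbhd E B v) + card (nbhd E S v)"
    if "v \<in> A \<union> B \<union> S" for v
    using deg[OF that] card_nbhd_Un[OF finite_UnI[OF fin(1,2)] fin(3), of E v]
      card_nbhd_Un[OF fin(1,2), of E v] by linarith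
  have S_le: "card (nbhd E S v) \<le> card S" for v
    by (rule card_nbhd_le[OF fin(3)])
  obtain a0 b0 where ab0: "a0 \<in> A" "b0 \<in> B" using ne by blast
  have A_ge: "d + 1 \<le> card A + p + card S"
    using split[of a0] cA[OF ab0(1)] S_le[of a0] self[OF ab0(1) fin(1)] ab0(1) by auto
  have B_ge: "d + 1 \<le> card B + p + card S"
    using split[of b0] cB[OF ab0(2)] S_le[of b0] self[OF ab0(2) fin(2)] ab0(2) by auto
  have A_le: "card A + d + 1 \<le> n + p" using B_ge cn by linarith
  show "k + 2 * q \<le> card A"
    using A_ge S d bound pq by linarith
  \<comment> \<open>Here the order bound is used in full: with \<open>card S = k - 1\<close> and
    \<open>A_le\<close> the claim reduces to
    \<open>n + 3 * k + 3 * p + 4 * q \<le> 3 * d + 5\<close>.\<close>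
  show "card A + 4 * q + (k - 1) \<le> 2 * card (nbhd E A a) + 1" if a: "a \<in> A" for a
    using split[of a] cA[OF a] S_le[of a] a A_le S d bound by auto
  show "k + 2 * q \<le> card (nbhd E A v)" if v: "v \<in> L" for v
  proof -
    have "d + 1 \<le> 2 * card (nbhd E A v) + card S"
      using split[of v] L(2)[OF v] self[of v S] v L(1) fin by auto
    then show ?thesis using S d bound pq by linarith
  qed
  show "card A + card L + 4 * q \<le> 2 * card (nbhd E (A \<union> L) a) + 3" if a: "a \<in> A" for a
  proof -
    have finL: "finite L" using L fin finite_subset by blast
    have cL: "card (S - L) + card L = card S"
      using L fin by (metis add.commute card_Diff_subset card_mono finL le_add_diff_inverse)
    have "A \<union> B \<union> S = (A \<union> L) \<union> (B \<union> (S - L))" using L by blast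
    then have "d \<le> card (nbhd E (A \<union> L) a) + card (nbhd E (B \<union> (S - L)) a)"
      using deg[of a] a card_nbhd_Un[of "A \<union> L" "B \<union> (S - L)" E a] fin finL by simp
    moreover have "card (nbhd E (B \<union> (S - L)) a) \<le> p + card (S - L)"
      using card_nbhd_Un[of B "S - L" E a] cA[OF a] card_nbhd_le[of "S - L" E a] fin by simp
    ultimately show ?thesis
      using cL A_le S d bound by linarith
  qed
qed

text \<open>Splitting off the closing edge lets \<open>path_edges_append\<close> describe a cycle
  glued from two paths; \<open>cycle_edges_conv_nth\<close> recovers the indices modulo the length
  used in \<open>cycle_graph\<close>.\<close>

definition cycle_edges :: "'a list \<Rightarrow> 'a set set" where
  "cycle_edges vs = insert {last vs, hd vs} (path_edges vs)"

text \<open>The removed set \<open>F\<close> may also contain crossing edges and edges of the other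
  side. Passing to the edges \<open>E'\<close> inside \<open>C \<union> L\<close> leaves only path
  edges to be removed, at most \<open>2 * q\<close> per vertex.\<close>

lemma connected_side:
  fixes q t :: nat
  assumes fin: "finite C" "finite T" and loopfree: "\<And>v. {v} \<notin> E"
    and degC: "\<And>u. u \<in> C \<Longrightarrow> card C + 4 * q + t \<le> 2 * card (nbhd E C u) + 1"
    and degL: "\<And>v. v \<in> L \<Longrightarrow> 2 * q + t + 1 \<le> card (nbhd E C v)"
    and F: "\<And>e. e \<in> F \<Longrightarrow> e \<subseteq> C \<union> L \<Longrightarrow> e \<in> E \<Longrightarrow> e \<in> (\<Union>i<q. path_edges (P i))"
    and P: "\<And>i. i < q \<Longrightarrow> distinct (P i)"
    and T: "card T \<le> t" and uv: "u \<in> C \<union> L - T" "v \<in> C \<union> L - T"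
  shows "(u, v) \<in> reach (E - F) T"
proof -
  define E' where "E' = {e \<in> E. e \<subseteq> C \<union> L}"
  have nb: "nbhd E' C w = nbhd E C w" if "w \<in> C \<union> L" for w
    using that by (auto simp: nbhd_def E'_def)
  have "(u, v) \<in> reach (E' - (\<Union>i<q. path_edges (P i))) T"
    unfolding reach_def
  proof (rule connected_after_deletion[OF fin _ _ _ card_nbhd_paths[OF P] T uv])
    show "{w} \<notin> E'" for w using loopfree by (simp add: E'_def)
  qed (use degC degL nb in auto)
  moreover have "E' - (\<Union>i<q. path_edges (P i)) \<subseteq> E - F"
    using F by (auto simp: E'_def)
  ultimately show ?thesis
    using reach_mono by blast
qed

section \<open>Assembling the cycles from paths and crossing edges\<close>

definition ham_cycle_packing :: "nat \<Rightarrow> nat \<Rightarrow> 'a set \<Rightarrow> 'a set set \<Rightarrow> (nat \<Rightarrow> 'a list) \<Rightarrow> bool" where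
  "ham_cycle_packing k q V E c \<longleftrightarrow>
     (\<forall>i<q. distinct (c i) \<and> set (c i) = V \<and> cycle_edges (c i) \<subseteq> E) \<and>
     (\<forall>i<q. \<forall>j<q. i \<noteq> j \<longrightarrow> cycle_edges (c i) \<inter> cycle_edges (c j) = {}) \<and>
     (\<forall>T\<subseteq>V. card T < k \<longrightarrow>
        (\<forall>u\<in>V - T. \<forall>v\<in>V - T. (u, v) \<in> reach (E - (\<Union>i<q. cycle_edges (c i))) T))"

lemma disjoint_ham_cycles:
  fixes k p q n d :: nat
  assumes fin: "finite A" "finite B" "finite S"
    and disj: "A \<inter> B = {}" "A \<inter> S = {}" "B \<inter> S = {}" and ne: "A \<noteq> {}" "B \<noteq> {}"
    and V: "V = A \<union> B \<union> S" and n: "card V = n" and E: "\<And>e. e \<in> E \<Longrightarrow> e \<subseteq> V \<and> card e = 2"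
    and deg: "\<And>v. v \<in> V \<Longrightarrow> d \<le> card (nbhd E V v)" and d: "n \<le> 2 * d"
    and cA: "\<And>a. a \<in> A \<Longrightarrow> card (nbhd E B a) \<le> p" and cB: "\<And>b. b \<in> B \<Longrightarrow> card (nbhd E A b) \<le> p"
    and S: "card S < k" and bound: "6 * k + 6 * p + 8 * q \<le> n + 10" and pq: "p \<ge> 1" "q \<ge> 1"
    and conn: "\<And>T u v. T \<subseteq> V \<Longrightarrow> card T < k \<Longrightarrow> u \<in> V - T \<Longrightarrow> v \<in> V - T \<Longrightarrow> (u, v) \<in> reach E T"
  shows "\<exists>c. ham_cycle_packing k q V E c"
proof -
  have finV: "finite V" using fin V by simp
  have loopfree: "{v} \<notin> E" for v using E[of "{v}"] by auto
  \<comment> \<open>Ties go to \<open>L1\<close>. Vertices of \<open>L2\<close> have strictly more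
    neighbours in \<open>B\<close>, so \<open>side_degrees\<close> also applies with
    \<open>A\<close> and \<open>B\<close> exchanged.\<close>
  define L1 where "L1 = {v \<in> S. card (nbhd E B v) \<le> card (nbhd E A v)}"
  define L2 where "L2 = S - L1"
  define V1 where "V1 = A \<union> L1"
  define V2 where "V2 = B \<union> L2"
  have L: "L1 \<subseteq> S" "L2 \<subseteq> S" by (auto simp: L1_def L2_def)
  have finL: "finite L1" "finite L2" using L fin finite_subset by blast+
  have V12: "V1 \<inter> V2 = {}" "V1 \<union> V2 = V"
    using L disj by (auto simp: V1_def V2_def L2_def V)
  have fin12: "finite V1" "finite V2" using V12 finV by (metis finite_Un)+
  note sd1 = side_degrees[OF fin disj ne n[unfolded V] loopfree deg[unfolded V] d cA cB S bound pq L(1)]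
  have sd1: "\<And>a. a \<in> A \<Longrightarrow> card A + card L1 + 4 * q \<le> 2 * card (nbhd E (A \<union> L1) a) + 3"
    "\<And>a. a \<in> A \<Longrightarrow> card A + 4 * q + (k - 1) \<le> 2 * card (nbhd E A a) + 1"
    "\<And>v. v \<in> L1 \<Longrightarrow> k + 2 * q \<le> card (nbhd E A v)" "k + 2 * q \<le> card A"
    by (rule sd1; simp add: L1_def)+
  have V': "A \<union> B \<union> S = B \<union> A \<union> S" by blast
  note sd2 = side_degrees[OF fin(2,1,3) _ disj(3,2) ne(2,1) n[unfolded V V'] loopfree
    deg[unfolded V V'] d cB cA S bound pq L(2)]
  have sd2: "\<And>a. a \<in> B \<Longrightarrow> card B + card L2 + 4 * q \<le> 2 * card (nbhd E (B \<union> L2) a) + 3"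
    "\<And>a. a \<in> B \<Longrightarrow> card B + 4 * q + (k - 1) \<le> 2 * card (nbhd E B a) + 1"
    "\<And>v. v \<in> L2 \<Longrightarrow> k + 2 * q \<le> card (nbhd E B v)" "k + 2 * q \<le> card B"
    by (rule sd2; use disj in \<open>auto simp: L1_def L2_def\<close>)+
  have Lk: "card L1 < k" "card L2 < k"
    using card_mono[OF fin(3) L(1)] card_mono[OF fin(3) L(2)] S by linarith+
  have big: "k + 2 * q \<le> card V1" "k + 2 * q \<le> card V2"
    using sd1(4) sd2(4) card_mono[OF fin12(1), of A] card_mono[OF fin12(2), of B]
    by (auto simp: V1_def V2_def)
  define X where "X = {(a, b). a \<in> V1 \<and> b \<in> V2 \<and> {a, b} \<in> E}"
  have XV: "X \<subseteq> V1 \<times> V2" by (auto simp: X_def)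
  have finX: "finite X" using XV fin12 finite_subset by blast
  \<comment> \<open>A cover of all crossing edges separates \<open>V1\<close> from
    \<open>V2\<close>, and neither side fits into fewer than \<open>k\<close> vertices. As
    \<open>T\<close> may leave \<open>V\<close>, the connectivity assumption is applied to
    \<open>T \<inter> V\<close>.\<close>
  have unc: "\<not> covers T X" if T: "finite T" "card T < k" for T
  proof
    assume cov: "covers T X"
    have T': "T \<inter> V \<subseteq> V" "card (T \<inter> V) < k"
      using T card_mono[of T "T \<inter> V"] by auto
    have "\<not> V1 \<subseteq> T" "\<not> V2 \<subseteq> T"
      using big T pq card_mono[OF T(1), of V1] card_mono[OF T(1), of V2] by linarith+
    then obtain u v where uv: "u \<in> V1 - T" "v \<in> V2 - T" by blast
    then have "(u, v) \<in> reach E (T \<inter> V)"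
      using V12 by (intro conn[OF T']) auto
    then obtain x y where xy: "x \<in> V1" "y \<notin> V1" "x \<notin> T \<inter> V" "y \<notin> T \<inter> V" "{x, y} \<in> E"
      using uv V12 reach_crossing[of u v E "T \<inter> V" V1] by blast
    then have "x \<in> V" "y \<in> V" using E by auto
    then have "(x, y) \<in> X" "x \<notin> T" "y \<notin> T" using xy V12 by (auto simp: X_def)
    then show False using cov by (auto simp: covers_def)
  qed
  obtain M where M: "M \<subseteq> X" "card M \<le> k" "\<And>T. finite T \<Longrightarrow> card T < k \<Longrightarrow> \<not> covers T M"
    using small_uncoverable_subset[OF finX XV V12(1) _ unc, of k] S by auto
  have "card M + 2 * q \<le> card {e \<in> X. fst e \<noteq> v \<and> snd e \<noteq> v} + 1" for v
  proof -
    have "k + 2 * q \<le> card {e \<in> X. fst e \<noteq> v \<and> snd e \<noteq> v} + 1"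
    proof (rule card_pairs_avoiding[OF fin12 XV V12(1) _ big])
      fix a b assume ab: "a \<in> V1" "b \<in> V2"
      have 1: "{y. (a, y) \<in> X} = nbhd E V2 a" "{x. (x, b) \<in> X} = nbhd E V1 b"
        using ab by (auto simp: X_def nbhd_def insert_commute)
      have "nbhd E V1 a \<subseteq> V1 - {a}" "nbhd E V2 b \<subseteq> V2 - {b}"
        using loopfree by (auto simp: nbhd_def)
      then have 2: "card (nbhd E V1 a) < card V1" "card (nbhd E V2 b) < card V2"
        using ab fin12 by (auto intro!: psubset_card_mono)
      have 3: "d \<le> card (nbhd E V1 w) + card (nbhd E V2 w)" if "w \<in> V" for w
        using deg[OF that] card_nbhd_Un[OF fin12, of E w] V12 by simp
      \<comment> \<open>On their own sides \<open>a\<close> and \<open>b\<close> have at most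
        \<open>card V1 - 1\<close> and \<open>card V2 - 1\<close> neighbours, so their crossing
        degrees add up to at least \<open>2 * d - n + 2\<close>.\<close>
      have "card V1 + card V2 = n"
        using n V12 fin12 by (metis card_Un_disjoint)
      then show "2 \<le> card {y. (a, y) \<in> X} + card {x. (x, b) \<in> X}"
        unfolding 1 using 2 3[of a] 3[of b] ab V12 d by auto
    qed
    then show ?thesis using M(2) by linarith
  qed
  then have "\<exists>e f. edge_pairs (X - M) q e f"
    by (rule many_disjoint_pairs[OF finX finite_subset[OF M(1) finX] XV V12(1)])
  then obtain e f where "edge_pairs (X - M) q e f" by blast
  then have ef: "\<And>i. i < q \<Longrightarrow> e i \<in> X - M \<and> f i \<in> X - M \<and> fst (e i) \<noteq> fst (f i) \<and> snd (e i) \<noteq> snd (f i)"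
    "\<And>i j. i < q \<Longrightarrow> j < q \<Longrightarrow> i \<noteq> j \<Longrightarrow> {e i, f i} \<inter> {e j, f j} = {}"
    unfolding edge_pairs_def by simp_all
  have efV: "fst (e i) \<in> V1" "snd (e i) \<in> V2" "fst (f i) \<in> V1" "snd (f i) \<in> V2"
    "{fst (e i), snd (e i)} \<in> E" "{fst (f i), snd (f i)} \<in> E" if "i < q" for i
    using ef(1)[OF that] by (auto simp: X_def)
  \<comment> \<open>The ends are chosen so that in \<open>P i @ Q i\<close> the junction is
    \<open>e i\<close> and the closing edge is \<open>f i\<close>.\<close>
  obtain P where P: "\<And>i. i < q \<Longrightarrow> ham_path E V1 (fst (f i)) (fst (e i)) (P i)"
    "\<And>i j. i < q \<Longrightarrow> j < q \<Longrightarrow> i \<noteq> j \<Longrightarrow> path_edges (P i) \<inter> path_edges (P j) = {}"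
  proof -
    have "\<exists>P. (\<forall>i<q. ham_path E (A \<union> L1) (fst (f i)) (fst (e i)) (P i)) \<and>
      (\<forall>i<q. \<forall>j<q. i \<noteq> j \<longrightarrow> path_edges (P i) \<inter> path_edges (P j) = {})"
    proof (rule disjoint_ham_paths[OF fin(1) finL(1) _ loopfree sd1(1)])
      show "A \<inter> L1 = {}" using L disj by blast
      show "card L1 + 2 * q \<le> card (nbhd E A v)" if "v \<in> L1" for v
        using sd1(3)[OF that] Lk by linarith
      show "fst (f i) \<in> A \<union> L1 \<and> fst (e i) \<in> A \<union> L1 \<and> fst (f i) \<noteq> fst (e i)" if "i < q" for i
        using ef(1)[OF that] efV[OF that] unfolding V1_def by metis
    qed
    then show ?thesis using that unfolding V1_def by blast
  qed
  obtain Q where Q: "\<And>i. i < q \<Longrightarrow> ham_path E V2 (snd (e i)) (snd (f i)) (Q i)"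
    "\<And>i j. i < q \<Longrightarrow> j < q \<Longrightarrow> i \<noteq> j \<Longrightarrow> path_edges (Q i) \<inter> path_edges (Q j) = {}"
  proof -
    have "\<exists>P. (\<forall>i<q. ham_path E (B \<union> L2) (snd (e i)) (snd (f i)) (P i)) \<and>
      (\<forall>i<q. \<forall>j<q. i \<noteq> j \<longrightarrow> path_edges (P i) \<inter> path_edges (P j) = {})"
    proof (rule disjoint_ham_paths[OF fin(2) finL(2) _ loopfree sd2(1)])
      show "B \<inter> L2 = {}" using L disj by blast
      show "card L2 + 2 * q \<le> card (nbhd E B v)" if "v \<in> L2" for v
        using sd2(3)[OF that] Lk by linarith
      show "snd (e i) \<in> B \<union> L2 \<and> snd (f i) \<in> B \<union> L2 \<and> snd (e i) \<noteq> snd (f i)" if "i < q" for i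
        using ef(1)[OF that] efV[OF that] unfolding V2_def by metis
    qed
    then show ?thesis using that unfolding V2_def by blast
  qed
  define c where "c i = P i @ Q i" for i
  define F where "F = (\<Union>i<q. cycle_edges (c i))"
  have PE: "g \<subseteq> V1 \<and> g \<in> E" if "g \<in> path_edges (P i)" "i < q" for g i
    using P(1)[OF that(2)] that(1) path_edges_subset[of g "P i"] by (auto simp: ham_path_def)
  have QE: "g \<subseteq> V2 \<and> g \<in> E" if "g \<in> path_edges (Q i)" "i < q" for g i
    using Q(1)[OF that(2)] that(1) path_edges_subset[of g "Q i"] by (auto simp: ham_path_def)
  have E12: "\<not> (g \<subseteq> V1 \<and> g \<subseteq> V2)" if "g \<in> E" for g
  proof
    assume "g \<subseteq> V1 \<and> g \<subseteq> V2"
    then have "g = {}" using V12(1) by blast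
    then show False using E[OF that] by simp
  qed
  have ce: "cycle_edges (c i) = path_edges (P i) \<union> path_edges (Q i) \<union>
      {{fst (e i), snd (e i)}, {fst (f i), snd (f i)}}" if "i < q" for i
    using P(1)[OF that] Q(1)[OF that]
    by (auto simp: cycle_edges_def c_def ham_path_def path_edges_append insert_commute)
  have cross: "\<not> {a, b} \<subseteq> V1" "\<not> {a, b} \<subseteq> V2" if "a \<in> V1" "b \<in> V2" for a b
    using that V12 by auto
  have inj: "(a, b) = (a', b')" if "{a, b} = {a', b'}" "a \<in> V1" "b \<in> V2" "a' \<in> V1" "b' \<in> V2" for a b a' b'
    using that V12 by (auto simp: doubleton_eq_iff)
  have ceE: "g \<in> E" if "g \<in> cycle_edges (c i)" "i < q" for g i
    using that(1) PE[OF _ that(2)] QE[OF _ that(2)] efV[OF that(2)] unfolding ce[OF that(2)] by blast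
  have on1: "g \<in> path_edges (P i)" if "g \<in> cycle_edges (c i)" "i < q" "g \<subseteq> V1" for g i
    using that(1,3) QE[OF _ that(2)] E12[of g] cross(1)[OF efV(1,2)[OF that(2)]]
      cross(1)[OF efV(3,4)[OF that(2)]] unfolding ce[OF that(2)] by blast
  have on2: "g \<in> path_edges (Q i)" if "g \<in> cycle_edges (c i)" "i < q" "g \<subseteq> V2" for g i
    using that(1,3) PE[OF _ that(2)] E12[of g] cross(2)[OF efV(1,2)[OF that(2)]]
      cross(2)[OF efV(3,4)[OF that(2)]] unfolding ce[OF that(2)] by blast
  \<comment> \<open>The cycles cross the cut only in the edges \<open>e i\<close> and
    \<open>f i\<close>, which were chosen outside \<open>M\<close>; so the reserved edges
    survive.\<close>
  have FM: "{a, b} \<notin> F" if "(a, b) \<in> M" for a b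
  proof
    assume "{a, b} \<in> F"
    then obtain i where i: "i < q" "{a, b} \<in> cycle_edges (c i)" by (auto simp: F_def)
    have ab: "a \<in> V1" "b \<in> V2" using that M(1) XV by auto
    have "{a, b} = {fst (e i), snd (e i)} \<or> {a, b} = {fst (f i), snd (f i)}"
      using i(2) PE[OF _ i(1)] QE[OF _ i(1)] cross[OF ab] unfolding ce[OF i(1)] by blast
    then have "(a, b) = e i \<or> (a, b) = f i"
      using inj[OF _ ab] efV[OF i(1)] by fastforce
    then show False using ef(1)[OF i(1)] that by auto
  qed
  have pairwise: "cycle_edges (c i) \<inter> cycle_edges (c j) = {}" if ij: "i < q" "j < q" "i \<noteq> j" for i j
  proof (rule ccontr)
    assume "\<not> ?thesis"
    then obtain g where g: "g \<in> cycle_edges (c i)" "g \<in> cycle_edges (c j)" by blast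
    consider "g \<subseteq> V1" | "g \<subseteq> V2" | "\<not> g \<subseteq> V1" "\<not> g \<subseteq> V2" by blast
    then show False
    proof cases
      case 1
      then show False using on1 g ij P(2) by blast
    next
      case 2
      then show False using on2 g ij Q(2) by blast
    next
      case 3
      \<comment> \<open>A shared crossing edge belongs to the chosen pair of either cycle;
        \<open>inj\<close> recovers its orientation, so the two pairs would meet.\<close>
      have "\<exists>x\<in>{e h, f h}. g = {fst x, snd x} \<and> x \<in> V1 \<times> V2" if "g \<in> cycle_edges (c h)" "h < q" for h
        using that(1) 3 PE[OF _ that(2)] QE[OF _ that(2)] efV[OF that(2)]
        unfolding ce[OF that(2)] by (auto simp: mem_Times_iff)
      then obtain x y where "x \<in> {e i, f i}" "y \<in> {e j, f j}" "g = {fst x, snd x}" "g = {fst y, snd y}"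
        "x \<in> V1 \<times> V2" "y \<in> V1 \<times> V2" using g ij by meson
      moreover from this have "x = y"
        using inj[of "fst x" "snd x" "fst y" "snd y"] by (auto simp: mem_Times_iff prod_eq_iff)
      ultimately show False using ef(2)[OF ij] by blast
    qed
  qed
  have ham: "distinct (c i) \<and> set (c i) = V \<and> cycle_edges (c i) \<subseteq> E" if "i < q" for i
    using P(1)[OF that] Q(1)[OF that] V12 ceE[OF _ that]
    by (auto simp: c_def ham_path_def)
  have rest: "(u, v) \<in> reach (E - F) T" if T: "T \<subseteq> V" "card T < k" and uv: "u \<in> V - T" "v \<in> V - T" for T u v
  proof -
    have finT: "finite T" and Tk: "card T \<le> k - 1" using T finV finite_subset by auto
    have r1: "(x, y) \<in> reach (E - F) T" if "x \<in> V1 - T" "y \<in> V1 - T" for x y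
    proof (rule connected_side[OF fin(1) finT loopfree sd1(2) _ _ _ Tk, of L1 F P])
      show "2 * q + (k - 1) + 1 \<le> card (nbhd E A w)" if "w \<in> L1" for w
        using sd1(3)[OF that] T by linarith
      show "g \<in> (\<Union>i<q. path_edges (P i))" if "g \<in> F" "g \<subseteq> A \<union> L1" "g \<in> E" for g
        using on1 that unfolding F_def V1_def by blast
      show "distinct (P i)" if "i < q" for i
        using P(1)[OF that] by (simp add: ham_path_def)
    qed (use that in \<open>auto simp: V1_def\<close>)
    have r2: "(x, y) \<in> reach (E - F) T" if "x \<in> V2 - T" "y \<in> V2 - T" for x y
    proof (rule connected_side[OF fin(2) finT loopfree sd2(2) _ _ _ Tk, of L2 F Q])
      show "2 * q + (k - 1) + 1 \<le> card (nbhd E B w)" if "w \<in> L2" for w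
        using sd2(3)[OF that] T by linarith
      show "g \<in> (\<Union>i<q. path_edges (Q i))" if "g \<in> F" "g \<subseteq> B \<union> L2" "g \<in> E" for g
        using on2 that unfolding F_def V2_def by blast
      show "distinct (Q i)" if "i < q" for i
        using Q(1)[OF that] by (simp add: ham_path_def)
    qed (use that in \<open>auto simp: V2_def\<close>)
    \<comment> \<open>The set \<open>T\<close> is too small to cover \<open>M\<close>, so a reserved
      edge survives and joins the two connected sides.\<close>
    obtain a b where ab: "(a, b) \<in> M" "a \<notin> T" "b \<notin> T"
      using M(3)[OF finT T(2)] by (auto simp: covers_def)
    then have abV: "a \<in> V1 - T" "b \<in> V2 - T" "{a, b} \<in> E" using M(1) by (auto simp: X_def)
    then have ba: "(b, a) \<in> reach (E - F) T"
      using ab FM by (intro reach_sym[OF reach_edge]) auto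
    have toa: "(w, a) \<in> reach (E - F) T" if "w \<in> V - T" for w
    proof (cases "w \<in> V1")
      case True
      then show ?thesis using r1 abV(1) that by blast
    next
      case False
      then show ?thesis using V12(2) that by (intro reach_trans[OF r2 ba] abV(2)) blast
    qed
    show ?thesis using reach_trans[OF toa[OF uv(1)] reach_sym[OF toa[OF uv(2)]]] .
  qed
  have "ham_cycle_packing k q V E c"
    unfolding ham_cycle_packing_def using ham pairwise rest[unfolded F_def] by simp
  then show ?thesis by blast
qed

subsection \<open>Connectivity of graphs\<close>

lemma cycle_edges_conv_nth:
  assumes "vs \<noteq> []"
  shows "cycle_edges vs = {{vs ! i, vs ! (Suc i mod length vs)} |i. i < length vs}"
proof -
  have "{{vs ! i, vs ! (Suc i mod length vs)} |i. i < length vs} =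
      {{vs ! i, vs ! Suc i} |i. Suc i < length vs} \<union> {{vs ! (length vs - 1), vs ! 0}}" (is "?L = ?R")
  proof
    show "?L \<subseteq> ?R"
    proof
      fix e assume "e \<in> ?L"
      then obtain i where i: "i < length vs" "e = {vs ! i, vs ! (Suc i mod length vs)}" by blast
      show "e \<in> ?R"
      proof (cases "Suc i < length vs")
        case True
        then show ?thesis using i by auto
      next
        case False
        then have last: "Suc i = length vs" using i(1) by simp
        then have "i = length vs - 1" by linarith
        moreover have "Suc i mod length vs = 0" using last by simp
        ultimately have "e = {vs ! (length vs - 1), vs ! 0}" using i(2) by simp
        then show ?thesis by blast
      qed
    qed
    show "?R \<subseteq> ?L"
    proof
      fix e assume "e \<in> ?R"
      then consider i where "Suc i < length vs" "e = {vs ! i, vs ! Suc i}"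
        | "e = {vs ! (length vs - 1), vs ! 0}" by blast
      then show "e \<in> ?L"
      proof cases
        case (1 i)
        then show ?thesis by (auto intro!: exI[of _ i])
      next
        case 2
        then show ?thesis using assms by (auto intro!: exI[of _ "length vs - 1"])
      qed
    qed
  qed
  then show ?thesis
    using assms by (auto simp: cycle_edges_def path_edges_conv_nth last_conv_nth hd_conv_nth)
qed

lemma k_connectedI:
  assumes "\<And>S. S \<subseteq> verts G \<Longrightarrow> card S < k \<Longrightarrow> connected_graph (del_verts G S) \<and> order (del_verts G S) \<ge> 2"
  shows "k_connected k G"
proof -
  let ?P = "\<lambda>m. \<exists>S \<subseteq> verts G. card S = m \<and>
        (\<not> connected_graph (del_verts G S) \<or> order (del_verts G S) \<le> 1)"
  \<comment> \<open>Deleting every vertex leaves order 0, so the minimum under \<open>LEAST\<close>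
    is attained.\<close>
  have "?P (card (verts G))"
    by (intro exI[of _ "verts G"]) (simp add: order_def del_verts_def)
  then have "?P (vertex_connectivity G)"
    unfolding vertex_connectivity_def by (rule LeastI)
  then obtain S where S: "S \<subseteq> verts G" "card S = vertex_connectivity G"
    "\<not> connected_graph (del_verts G S) \<or> order (del_verts G S) \<le> 1" by blast
  then show ?thesis
    using assms[OF S(1)] unfolding k_connected_def by fastforce
qed

lemma k_connectedD:
  assumes "k_connected k G" "S \<subseteq> verts G" "card S < k"
  shows "connected_graph (del_verts G S)"
proof (rule ccontr)
  assume "\<not> ?thesis"
  then have "vertex_connectivity G \<le> card S"
    unfolding vertex_connectivity_def using assms(2) by (intro Least_le) auto
  then show False using assms by (simp add: k_connected_def)
qed

lemma rel_del_verts: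
  "{(x, y). {x, y} \<in> edges (del_verts G S)} = {(x, y). x \<notin> S \<and> y \<notin> S \<and> {x, y} \<in> edges G}"
  by (auto simp: del_verts_def)

lemma connected_del_verts_iff:
  "connected_graph (del_verts G S) \<longleftrightarrow>
    (\<forall>u\<in>verts G - S. \<forall>v\<in>verts G - S. (u, v) \<in> reach (edges G) S)"
  unfolding connected_graph_def rel_del_verts reach_def by (simp add: del_verts_def)

lemma card_nbhd_eq_degree:
  assumes "fin_simple_graph G" "v \<in> verts G"
  shows "card (nbhd (edges G) (verts G) v) = degree G v"
proof -
  have "{e \<in> edges G. v \<in> e} = (\<lambda>w. {v, w}) ` nbhd (edges G) (verts G) v"
  proof
    show "{e \<in> edges G. v \<in> e} \<subseteq> (\<lambda>w. {v, w}) ` nbhd (edges G) (verts G) v"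
    proof
      fix e assume "e \<in> {e \<in> edges G. v \<in> e}"
      then have e: "e \<in> edges G" "v \<in> e" "e \<subseteq> verts G" "card e = 2"
        using assms(1) by (auto simp: fin_simple_graph_def)
      then obtain w where "e = {v, w}" by (metis card_2_iff insert_commute insertE singletonD)
      then show "e \<in> (\<lambda>w. {v, w}) ` nbhd (edges G) (verts G) v"
        using e by (auto simp: nbhd_def)
    qed
  qed (auto simp: nbhd_def)
  moreover have "inj_on (\<lambda>w. {v, w}) (nbhd (edges G) (verts G) v)"
    by (auto simp: inj_on_def doubleton_eq_iff)
  ultimately show ?thesis
    by (simp add: degree_def card_image)
qed

text \<open>As \<open>order G > k\<close>, connectivity below \<open>k\<close> cannot come from
  having too few vertices, so fewer than \<open>k\<close> vertices \<open>S\<close> disconnect the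
  graph without the edges of \<open>H\<close>. Take \<open>A\<close> as the component of one
  remaining vertex and \<open>B\<close> as the rest: every edge of \<open>G\<close> between them
  belongs to \<open>H\<close>, whose degrees are at most \<open>p\<close>.\<close>

lemma sparse_cut:
  assumes G: "fin_simple_graph G" and H: "spanning_subgraph H G" "max_degree H \<le> p"
    and nk: "\<not> k_connected k (del_edges G (edges H))" and n: "order G > k"
  obtains A B S where "A \<union> B \<union> S = verts G" "A \<inter> B = {}" "A \<inter> S = {}" "B \<inter> S = {}"
    "A \<noteq> {}" "B \<noteq> {}" "card S < k"
    "\<And>a. a \<in> A \<Longrightarrow> card (nbhd (edges G) B a) \<le> p" "\<And>b. b \<in> B \<Longrightarrow> card (nbhd (edges G) A b) \<le> p"
proof -
  define V where "V = verts G"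
  have finV: "finite V" and VH: "verts H = V" and EH: "edges H \<subseteq> edges G"
    using G H by (auto simp: V_def fin_simple_graph_def spanning_subgraph_def)
  have simpH: "fin_simple_graph H"
    using G H by (auto simp: fin_simple_graph_def spanning_subgraph_def)
  have degH: "card (nbhd (edges H) V v) \<le> p" if "v \<in> V" for v
  proof -
    have "degree H v \<le> max_degree H"
      unfolding max_degree_def using that finV VH by (intro Max_ge) auto
    then show ?thesis
      using card_nbhd_eq_degree[OF simpH] that VH H(2) by simp
  qed
  let ?G = "del_edges G (edges H)"
  obtain S where S: "S \<subseteq> V" "card S < k"
    "\<not> (connected_graph (del_verts ?G S) \<and> order (del_verts ?G S) \<ge> 2)"
    using nk k_connectedI[of ?G k] by (auto simp: del_edges_def V_def)
  have "order (del_verts ?G S) + card S = card V"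
    using S(1) finV by (simp add: order_def del_verts_def del_edges_def V_def card_Diff_subset
        finite_subset card_mono)
  then have "order (del_verts ?G S) \<ge> 2"
    using S(2) n by (simp add: order_def V_def)
  then obtain u v where uv: "u \<in> V - S" "v \<in> V - S" "(u, v) \<notin> reach (edges G - edges H) S"
    using S(3) unfolding connected_del_verts_iff by (auto simp: del_edges_def V_def)
  define A where "A = {w \<in> V - S. (u, w) \<in> reach (edges G - edges H) S}"
  define B where "B = V - S - A"
  have cross: "{a, b} \<in> edges H" if "a \<in> A" "b \<in> B" "{a, b} \<in> edges G" for a b
  proof (rule ccontr)
    assume "{a, b} \<notin> edges H"
    then have "(a, b) \<in> reach (edges G - edges H) S"
      using that by (intro reach_edge) (auto simp: A_def B_def)
    then have "b \<in> A"
      using that reach_trans[of u a _ S b] by (auto simp: A_def B_def)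
    then show False using that by (simp add: B_def)
  qed
  show ?thesis
  proof
    show "A \<union> B \<union> S = verts G" using S(1) by (auto simp: A_def B_def V_def)
    show "A \<inter> B = {}" "A \<inter> S = {}" "B \<inter> S = {}" by (auto simp: A_def B_def)
    show "A \<noteq> {}" using uv by (auto simp: A_def reach_def)
    show "B \<noteq> {}" using uv by (auto simp: A_def B_def)
    show "card S < k" by fact
    show "card (nbhd (edges G) B a) \<le> p" if "a \<in> A" for a
    proof -
      have "nbhd (edges G) B a \<subseteq> nbhd (edges H) V a"
        using cross[OF that] by (auto simp: nbhd_def B_def)
      then have "card (nbhd (edges G) B a) \<le> card (nbhd (edges H) V a)"
        using finV by (intro card_mono) auto
      then show ?thesis using degH[of a] that by (simp add: A_def)
    qed
    show "card (nbhd (edges G) A b) \<le> p" if "b \<in> B" for b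
    proof -
      have "nbhd (edges G) A b \<subseteq> nbhd (edges H) V b"
        using cross[OF _ that] by (auto simp: nbhd_def A_def insert_commute)
      then have "card (nbhd (edges G) A b) \<le> card (nbhd (edges H) V b)"
        using finV by (intro card_mono) auto
      then show ?thesis using degH[of b] that by (simp add: B_def)
    qed
  qed
qed

section \<open>The dichotomy for graphs of minimum degree at least half the order\<close>

theorem theorem12:
  fixes G :: "'a graph" and k p q n :: nat
  assumes "k \<ge> 2" and "p \<ge> 1" and "q \<ge> 1"
    and "fin_simple_graph G"
    and "order G = n"
    and "k_connected k G"
    and "int n \<ge>
      max (6 * (int k + int p) + 8 * (int q - 1) - 2 * \<lceil>(real k - 2) / real k\<rceil>)
          (int k * (int q + 3) + max ((int k - 2) * int q - 2) (2 * int p)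
             + 2 * max (int p) (int q) - 4)"
    and "real (min_degree G) \<ge> real n / 2"
  shows "(\<forall>H. spanning_subgraph H G \<and> max_degree H \<le> p \<longrightarrow> k_connected k (del_edges G (edges H)))
       \<or> (\<exists>H :: nat \<Rightarrow> 'a graph.
            (\<forall>i\<in>{1..q}. hamiltonian_cycle (H i) G) \<and>
            (\<forall>i\<in>{1..q}. \<forall>j\<in>{1..q}. i \<noteq> j \<longrightarrow> edges (H i) \<inter> edges (H j) = {}) \<and>
            k_connected k (del_edges G (\<Union>i\<in>{1..q}. edges (H i))))"
proof (cases "\<forall>H. spanning_subgraph H G \<and> max_degree H \<le> p \<longrightarrow> k_connected k (del_edges G (edges H))")
  case False
  then obtain H where H: "spanning_subgraph H G" "max_degree H \<le> p"
    "\<not> k_connected k (del_edges G (edges H))" by blast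
  define V where "V = verts G"
  define E where "E = edges G"
  have finV: "finite V" and EV: "\<And>e. e \<in> E \<Longrightarrow> e \<subseteq> V \<and> card e = 2"
    using assms(4) by (auto simp: fin_simple_graph_def V_def E_def)
  have nV: "card V = n" using assms(5) by (simp add: order_def V_def)
  \<comment> \<open>The ceiling is at most 1, so the first term of the maximum yields
    \<open>6 * k + 6 * p + 8 * q \<le> n + 10\<close>, the form needed for
    \<open>side_degrees\<close>.\<close>
  have "(real k - 2) / real k \<le> 1" using assms(1) by (simp add: divide_simps)
  then have "\<lceil>(real k - 2) / real k\<rceil> \<le> 1" by (simp add: ceiling_le_iff)
  moreover have "6 * (int k + int p) + 8 * (int q - 1) - 2 * \<lceil>(real k - 2) / real k\<rceil> \<le> int n"
    using assms(7) by (rule max.boundedE)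
  moreover define z where "z = \<lceil>(real k - 2) / real k\<rceil>"
  ultimately have "z \<le> 1" "6 * (int k + int p) + 8 * (int q - 1) - 2 * z \<le> int n"
    by (simp_all only:)
  then have "int (6 * k + 6 * p + 8 * q) \<le> int (n + 10)"
    by simp
  then have bound: "6 * k + 6 * p + 8 * q \<le> n + 10"
    by (simp only: of_nat_le_iff)
  then have n: "n > k" "n \<ge> 3" using assms(1-3) by linarith+
  obtain A B S where cut: "A \<union> B \<union> S = V" "A \<inter> B = {}" "A \<inter> S = {}" "B \<inter> S = {}"
    "A \<noteq> {}" "B \<noteq> {}" "card S < k"
    "\<And>a. a \<in> A \<Longrightarrow> card (nbhd E B a) \<le> p" "\<And>b. b \<in> B \<Longrightarrow> card (nbhd E A b) \<le> p"
    using sparse_cut[OF assms(4) H] n(1) assms(5) unfolding V_def E_def by metis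
  have fin: "finite A" "finite B" "finite S" using finV cut(1) by auto
  have deg: "min_degree G \<le> card (nbhd E V v)" if "v \<in> V" for v
    unfolding V_def E_def using that finV
    by (subst card_nbhd_eq_degree[OF assms(4)]) (auto simp: min_degree_def V_def)
  have md: "n \<le> 2 * min_degree G" using assms(8) by linarith
  have conn: "(u, v) \<in> reach E T" if "T \<subseteq> V" "card T < k" "u \<in> V - T" "v \<in> V - T" for T u v
    using k_connectedD[OF assms(6), of T] that unfolding connected_del_verts_iff V_def E_def by blast
  obtain c where "ham_cycle_packing k q V E c"
    using disjoint_ham_cycles[OF fin cut(2-6) cut(1)[symmetric] nV EV deg md cut(8,9) cut(7)
        bound assms(2,3) conn] by blast
  then have c: "\<And>i. i < q \<Longrightarrow> distinct (c i) \<and> set (c i) = V \<and> cycle_edges (c i) \<subseteq> E"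
    "\<And>i j. i < q \<Longrightarrow> j < q \<Longrightarrow> i \<noteq> j \<Longrightarrow> cycle_edges (c i) \<inter> cycle_edges (c j) = {}"
    "\<And>T u v. T \<subseteq> V \<Longrightarrow> card T < k \<Longrightarrow> u \<in> V - T \<Longrightarrow> v \<in> V - T \<Longrightarrow>
      (u, v) \<in> reach (E - (\<Union>i<q. cycle_edges (c i))) T"
    unfolding ham_cycle_packing_def by simp_all
  \<comment> \<open>The packing is indexed from 0 and the statement from 1, hence the shift.\<close>
  define C where "C i = \<lparr>verts = V, edges = cycle_edges (c (i - 1))\<rparr>" for i
  have ham: "hamiltonian_cycle (C i) G" if "i \<in> {1..q}" for i
  proof -
    have less: "i - 1 < q" using that by (cases i) auto
    have c1: "distinct (c (i - 1))" "set (c (i - 1)) = V" "cycle_edges (c (i - 1)) \<subseteq> E"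
      using c(1)[of "i - 1"] less by auto
    then have len: "length (c (i - 1)) = n" using nV distinct_card by fastforce
    then have "c (i - 1) \<noteq> []" using n by auto
    then show ?thesis
      using c1 len n cycle_edges_conv_nth[of "c (i - 1)"]
      unfolding hamiltonian_cycle_def cycle_graph_def spanning_subgraph_def
      by (auto simp: C_def V_def E_def intro!: exI[of _ "c (i - 1)"])
  qed
  have un: "(\<Union>i\<in>{1..q}. edges (C i)) = (\<Union>i<q. cycle_edges (c i))"
  proof -
    have "{..<q} = (\<lambda>i. i - 1) ` {1..q}"
      by (auto simp: image_iff intro!: bexI[of _ "Suc _"])
    then show ?thesis by (simp add: C_def)
  qed
  have "k_connected k (del_edges G (\<Union>i\<in>{1..q}. edges (C i)))"
  proof (rule k_connectedI)
    fix T assume "T \<subseteq> verts (del_edges G (\<Union>i\<in>{1..q}. edges (C i)))" and Tk: "card T < k"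
    then have T: "T \<subseteq> V" by (simp add: del_edges_def V_def)
    have "card (V - T) \<ge> 2"
      using T Tk finV nV n bound assms(1-3) by (simp add: card_Diff_subset finite_subset)
    then show "connected_graph (del_verts (del_edges G (\<Union>i\<in>{1..q}. edges (C i))) T) \<and>
        order (del_verts (del_edges G (\<Union>i\<in>{1..q}. edges (C i))) T) \<ge> 2"
      unfolding connected_del_verts_iff un using c(3)[OF T Tk]
      by (simp add: del_edges_def del_verts_def order_def V_def E_def)
  qed
  moreover have "edges (C i) \<inter> edges (C j) = {}" if "i \<in> {1..q}" "j \<in> {1..q}" "i \<noteq> j" for i j
  proof -
    have "i - 1 < q" "j - 1 < q" "i - 1 \<noteq> j - 1" using that by (cases i; cases j; simp)+
    then show ?thesis using c(2) by (simp add: C_def)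
  qed
  ultimately show ?thesis using ham by blast
qed simp

end
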